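(* Let $A^-_4$ be the oriented path on vertices $s_1,s_2,s_3,s_4,s_5$ with arcs $s_2s_1,\ s_2s_3,\ s_4s_3,\ s_4s_5$. The problem $\Pi'_{A^-_4}$ (given an oriented graph $G$, does $G$ contain an induced subdivision of $A^-_4$?) is polynomial-time solvable.
   Context: All digraphs are finite and simple (no loops, no parallel arcs). An oriented graph is a digraph with no directed 2-cycle. A subdivision of a digraph $D$ is a digraph obtained from $D$ by replacing each arc $ab$ by a directed $(a,b)$-path of length at least 1, these paths being internally disjoint with new internal vertices. An induced subdivision of $D$ in $G$ is an induced subdigraph of $G$ that is (isomorphic to) a subdivision of $D$. For a fixed digraph $D$, $\Pi'_D$ is the decision problem: Input: an oriented graph $G$. Question: does $G$ contain an induced subdivision of $D$? *)

theory Defs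
  imports
    "Graph_Theory.Graph_Theory"
    "HOL-Computational_Algebra.Polynomial"
begin

section \<open>Oriented graphs and induced subdivisions\<close>

definition oriented_graph :: "'a pair_pre_digraph \<Rightarrow> bool" where
  "oriented_graph G \<longleftrightarrow>
     pair_digraph G \<and> (\<forall>u v. (u, v) \<in> parcs G \<longrightarrow> (v, u) \<notin> parcs G)"

text \<open>\<open>Q e\<close> lists, in order, the new internal vertices of the path that replaces the arc \<open>e\<close>;
  the empty list leaves the arc as it is. The vertices of \<open>D\<close> keep their names, so the vertex
  type has to be infinite for all subdivisions of a finite \<open>D\<close> to be present up to isomorphism.
  The constant \<open>subdivision\<close> of the library is about bidirected digraphs only.\<close>

definition subdivision_path :: "('a \<times> 'a \<Rightarrow> 'a list) \<Rightarrow> 'a \<times> 'a \<Rightarrow> 'a list" where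
  "subdivision_path Q e = fst e # Q e @ [snd e]"

definition is_subdivision_of :: "'a pair_pre_digraph \<Rightarrow> 'a pair_pre_digraph \<Rightarrow> bool" where
  "is_subdivision_of H D \<longleftrightarrow> (\<exists>Q.
     (\<forall>e \<in> parcs D. distinct (Q e) \<and> set (Q e) \<inter> pverts D = {}) \<and>
     (\<forall>e \<in> parcs D. \<forall>e' \<in> parcs D. e \<noteq> e' \<longrightarrow> set (Q e) \<inter> set (Q e') = {}) \<and>
     pverts H = pverts D \<union> (\<Union>e \<in> parcs D. set (Q e)) \<and>
     parcs H = (\<Union>e \<in> parcs D. set (vwalk_arcs (subdivision_path Q e))))"

definition contains_induced_subdivision ::
    "'a pair_pre_digraph \<Rightarrow> 'b pair_pre_digraph \<Rightarrow> bool" where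
  "contains_induced_subdivision G D \<longleftrightarrow> (\<exists>K H.
     induced_subgraph (with_proj K) (with_proj G) \<and>
     is_subdivision_of H D \<and> digraph_iso (with_proj H) (with_proj K))"

definition A4_minus :: "nat pair_pre_digraph" where
  "A4_minus = \<lparr> pverts = {1, 2, 3, 4, 5}, parcs = {(2, 1), (2, 3), (4, 3), (4, 5)} \<rparr>"


section \<open>Polynomial time\<close>

text \<open>The machine model is a unit-cost random access machine, programmed with structured control
  flow. A program uses finitely many registers and finitely many arrays of natural numbers. There
  is addition and truncated subtraction but no multiplication, so one step increases the bit length
  of the largest stored number by at most a constant depending on the program. Hence polynomial
  time on this machine is polynomial time on Turing machines.\<close>

datatype aexp =
    Const nat
  | Reg nat
  | Cell nat aexp  \<comment> \<open>\<open>Cell a i\<close> is the entry of array \<open>a\<close> at index \<open>i\<close>\<close>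
  | Plus aexp aexp
  | Minus aexp aexp

datatype bexp =
    Less aexp aexp
  | Equal aexp aexp
  | Neg bexp
  | Conj bexp bexp

datatype com =
    Skip
  | SetReg nat aexp
  | SetCell nat aexp aexp  \<comment> \<open>array, index, new value\<close>
  | Seq com com
  | Cond bexp com com
  | While bexp com

record state =
  regs :: "nat \<Rightarrow> nat"
  arrays :: "nat \<Rightarrow> nat \<Rightarrow> nat"

primrec aval :: "aexp \<Rightarrow> state \<Rightarrow> nat" where
  "aval (Const n) s = n"
| "aval (Reg x) s = regs s x"
| "aval (Cell a i) s = arrays s a (aval i s)"
| "aval (Plus d e) s = aval d s + aval e s"
| "aval (Minus d e) s = aval d s - aval e s"

primrec bval :: "bexp \<Rightarrow> state \<Rightarrow> bool" where
  "bval (Less d e) s \<longleftrightarrow> aval d s < aval e s"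
| "bval (Equal d e) s \<longleftrightarrow> aval d s = aval e s"
| "bval (Neg b) s \<longleftrightarrow> \<not> bval b s"
| "bval (Conj b c) s \<longleftrightarrow> bval b s \<and> bval c s"

text \<open>\<open>exec c s t s'\<close>: started in \<open>s\<close>, the program \<open>c\<close> halts in \<open>s'\<close> after \<open>t\<close> steps. Every
  assignment and every test counts as one step; the size of the expressions in it is fixed by the
  program and only affects a constant factor.\<close>

inductive exec :: "com \<Rightarrow> state \<Rightarrow> nat \<Rightarrow> state \<Rightarrow> bool" where
  Skip: "exec Skip s 1 s"
| SetReg: "exec (SetReg x e) s 1 (s\<lparr>regs := (regs s)(x := aval e s)\<rparr>)"
| SetCell: "exec (SetCell a i e) s 1
    (s\<lparr>arrays := (arrays s)(a := (arrays s a)(aval i s := aval e s))\<rparr>)"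
| Seq: "exec c1 s1 t1 s2 \<Longrightarrow> exec c2 s2 t2 s3 \<Longrightarrow> exec (Seq c1 c2) s1 (t1 + t2) s3"
| CondTrue: "bval b s \<Longrightarrow> exec c1 s t s' \<Longrightarrow> exec (Cond b c1 c2) s (1 + t) s'"
| CondFalse: "\<not> bval b s \<Longrightarrow> exec c2 s t s' \<Longrightarrow> exec (Cond b c1 c2) s (1 + t) s'"
| WhileFalse: "\<not> bval b s \<Longrightarrow> exec (While b c) s 1 s"
| WhileTrue: "bval b s1 \<Longrightarrow> exec c s1 t1 s2 \<Longrightarrow> exec (While b c) s2 t2 s3 \<Longrightarrow>
    exec (While b c) s1 (1 + t1 + t2) s3"

inductive_cases SkipE: "exec Skip s t s'"
inductive_cases SetRegE: "exec (SetReg x e) s t s'"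
inductive_cases SetCellE: "exec (SetCell a i e) s t s'"
inductive_cases SeqE: "exec (Seq c1 c2) s t s'"
inductive_cases CondE: "exec (Cond b c1 c2) s t s'"
inductive_cases WhileE: "exec (While b c) s t s'"

lemma exec_deterministic:
  "exec c s t s' \<Longrightarrow> exec c s u s'' \<Longrightarrow> u = t \<and> s'' = s'"
proof (induction arbitrary: u s'' rule: exec.induct)
  case (Skip s)
  then show ?case by (rule SkipE) simp
next
  case (SetReg x e s)
  then show ?case by (rule SetRegE) simp
next
  case (SetCell a i e s)
  then show ?case by (rule SetCellE) simp
next
  case (Seq c1 s1 t1 s2 c2 t2 s3)
  from Seq.prems show ?case by (rule SeqE) (auto dest!: Seq.IH)
next
  case (CondTrue b s c1 t s' c2)
  from CondTrue.prems show ?case by (rule CondE) (auto dest: CondTrue.IH simp: CondTrue.hyps(1))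
next
  case (CondFalse b s c2 t s' c1)
  from CondFalse.prems show ?case by (rule CondE) (auto dest: CondFalse.IH simp: CondFalse.hyps(1))
next
  case (WhileFalse b s c)
  from WhileFalse.prems show ?case by (rule WhileE) (auto simp: WhileFalse.hyps)
next
  case (WhileTrue b s1 c t1 s2 t2 s3)
  from WhileTrue.prems show ?case by (rule WhileE) (auto dest!: WhileTrue.IH simp: WhileTrue.hyps(1))
qed

text \<open>The input word is in array 0 and its length in register 0; everything else is 0.\<close>

definition initial_state :: "bool list \<Rightarrow> state" where
  "initial_state w =
     \<lparr> regs = (\<lambda>x. if x = 0 then length w else 0),
       arrays = (\<lambda>a i. if a = 0 \<and> i < length w \<and> w ! i then 1 else 0) \<rparr>"

definition polynomial_time_decidable :: "bool list set \<Rightarrow> bool" where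
  "polynomial_time_decidable L \<longleftrightarrow> (\<exists>(c :: com) (p :: nat poly). \<forall>w. \<exists>t s.
     exec c (initial_state w) t s \<and> t \<le> poly p (length w) \<and> (regs s 0 = 1 \<longleftrightarrow> w \<in> L))"


section \<open>The decision problem\<close>

text \<open>A digraph on \<open>{..<n}\<close> is encoded by its adjacency matrix, row by row. The length of the
  code is the square of \<open>n\<close>, so the code determines the digraph, and time polynomial in the length
  is time polynomial in \<open>n\<close>. Every finite digraph is isomorphic to one on \<open>{..<n}\<close>.\<close>

definition encode_digraph :: "nat pair_pre_digraph \<Rightarrow> bool list" where
  "encode_digraph G = (let n = card (pverts G) in
     concat (map (\<lambda>u. map (\<lambda>v. (u, v) \<in> parcs G) [0..<n]) [0..<n]))"

definition Pi' :: "nat pair_pre_digraph \<Rightarrow> bool list set" where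
  "Pi' D = {encode_digraph G | G. oriented_graph G \<and> (\<exists>n. pverts G = {..<n}) \<and>
     contains_induced_subdivision G D}"

end

(*
  Induced subdivisions of A4-minus: it suffices to look for arcs b -> a and c -> d that are not
  joined by any further arc, and a vertex x that is reachable from b and from c by paths whose later
  vertices avoid a, d and their neighbours and the in-neighbours of b and c. If there is such an x,
  choose it with minimal sum of the two distances. Then minimality and the absence of 2-cycles forbid
  every arc between the two shortest paths, every forward chord and every arc leaving x; only backward
  chords inside one path remain, and the last of these replaces the end arc b -> a or c -> d.
  Hence trying all quadruples and computing reachability decides the problem in polynomial time.
*)
theory Submission
  imports Defs
begin

section \<open>Characterisation by reachability\<close>

text \<open>The obstacle is that shortest paths need not be induced: backward chords survive, and
  demanding their absence in advance would no longer be a reachability question. The pattern escapes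
  because each end of it is a sink attached to a source. If \<open>p k\<close> has an arc back to an
  earlier vertex, that arc already has the shape of an end arc; so \<open>p k\<close> becomes the
  new source, the earlier vertex its sink, and only the tail from \<open>p k\<close> on is kept. A
  chord back to the immediate predecessor could not play this role, since the path arc in the other
  direction would remain between the two vertices; this is where orientedness enters, and again
  where the meeting vertex is shown to be a sink.

  Conversely, the paths replacing the two outer arcs may be cut to their first arcs, which is why
  guessing four vertices is enough. All restrictions on later vertices compare one vertex with this
  quadruple, hence merely delete arcs; the program tests nothing about the relation between the two
  paths and computes no distances. Minimality appears only in the proof.\<close>

text \<open>An isomorphism consists of a vertex map, an arc map and two end maps, but between pair
  digraphs the vertex map determines the others. The copy \<open>K\<close> inside \<open>G\<close>
  is then the image of \<open>H\<close>, so only an injection \<open>h\<close> matching arcs with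
  induced arcs remains.\<close>

lemma contains_induced_subdivision_iff:
  "contains_induced_subdivision G D \<longleftrightarrow> pair_wf_digraph G \<and> (\<exists>H h.
     is_subdivision_of H D \<and> pair_wf_digraph H \<and> inj_on h (pverts H) \<and> h ` pverts H \<subseteq> pverts G \<and>
     map_prod h h ` parcs H = parcs G \<inter> h ` pverts H \<times> h ` pverts H)"
  (is "?lhs \<longleftrightarrow> ?rhs")
proof
  assume ?lhs
  then obtain K H where K: "induced_subgraph (with_proj K) (with_proj G)"
    and H: "is_subdivision_of H D" "digraph_iso (with_proj H) (with_proj K)"
    unfolding contains_induced_subdivision_def by blast
  obtain f where f: "pre_digraph.digraph_isomorphism (with_proj H) f"
    and Kf: "with_proj K = app_iso f (with_proj H)"
    using H(2) unfolding digraph_iso_def by blast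
  let ?h = "iso_verts f"
  from Kf have pv: "pverts K = ?h ` pverts H" and pa: "parcs K = iso_arcs f ` parcs H"
    and ht: "iso_head f = snd" "iso_tail f = fst"
    by (auto simp: with_proj_def app_iso_def)
  have wfs: "wf_digraph (with_proj H)" "wf_digraph (with_proj G)"
    using f K unfolding pre_digraph.digraph_isomorphism_def induced_subgraph_def subgraph_def by blast+
  then have "pair_wf_digraph H" "pair_wf_digraph G"
    by (auto simp: wf_digraph_def pair_wf_digraph_def)
  moreover have "inj_on ?h (pverts H)"
    using f unfolding pre_digraph.digraph_isomorphism_def by auto
  moreover have "?h ` pverts H \<subseteq> pverts G"
    using K pv unfolding induced_subgraph_def subgraph_def by auto
  moreover have arcs: "map_prod ?h ?h ` parcs H = iso_arcs f ` parcs H"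
  proof (intro image_cong refl prod_eqI)
    fix e assume "e \<in> parcs H"
    then have "?h (fst e) = iso_tail f (iso_arcs f e)" "?h (snd e) = iso_head f (iso_arcs f e)"
      using f unfolding pre_digraph.digraph_isomorphism_def by simp_all
    then show "fst (map_prod ?h ?h e) = fst (iso_arcs f e)" "snd (map_prod ?h ?h e) = snd (iso_arcs f e)"
      by (simp_all add: ht)
  qed
  moreover have "parcs K = {e \<in> parcs G. fst e \<in> pverts K \<and> snd e \<in> pverts K}"
    using K unfolding induced_subgraph_def by simp
  then have "map_prod ?h ?h ` parcs H = parcs G \<inter> ?h ` pverts H \<times> ?h ` pverts H"
    unfolding arcs pa[symmetric] pv[symmetric] by (rule trans) auto
  ultimately show ?rhs using H(1) by blast
next
  assume ?rhs
  then obtain H h where G: "pair_wf_digraph G" and H: "is_subdivision_of H D" "pair_wf_digraph H"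
    and h: "inj_on h (pverts H)" "h ` pverts H \<subseteq> pverts G"
    and eq: "map_prod h h ` parcs H = parcs G \<inter> h ` pverts H \<times> h ` pverts H"
    by blast
  define K where "K = \<lparr>pverts = h ` pverts H, parcs = map_prod h h ` parcs H\<rparr>"
  interpret H: pair_wf_digraph H by fact
  interpret G: pair_wf_digraph G by fact
  have "wf_digraph (with_proj K)"
    using eq by (auto simp: wf_digraph_def K_def)
  then have "induced_subgraph (with_proj K) (with_proj G)"
    using eq h(2) G.wf_digraph_axioms
    unfolding induced_subgraph_def subgraph_def compatible_def by (auto simp: K_def)
  moreover have "digraph_iso (with_proj H) (with_proj K)"
    unfolding digraph_iso_def
  proof (intro exI conjI)
    let ?f = "\<lparr>iso_verts = h, iso_arcs = map_prod h h, iso_head = snd, iso_tail = fst\<rparr>"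
    have "parcs H \<subseteq> pverts H \<times> pverts H"
      by (auto dest: H.wellformed')
    then have "inj_on (map_prod h h) (parcs H)"
      using map_prod_inj_on[OF h(1) h(1)] inj_on_subset by blast
    then show "pre_digraph.digraph_isomorphism (with_proj H) ?f"
      using h(1) H.wf_digraph_axioms unfolding pre_digraph.digraph_isomorphism_def by auto
    show "with_proj K = app_iso ?f (with_proj H)"
      by (auto simp: K_def app_iso_def with_proj_def)
  qed
  ultimately show ?lhs
    unfolding contains_induced_subdivision_def using H(1) by blast
qed

lemma oriented_graphD:
  assumes "oriented_graph G"
  shows "pair_wf_digraph G" "finite (parcs G)" "(u, v) \<in> parcs G \<Longrightarrow> (v, u) \<notin> parcs G"
  using assms unfolding oriented_graph_def pair_digraph_def pair_fin_digraph_def pair_fin_digraph_axioms_def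
  by auto

section \<open>End arcs and inner vertices\<close>

text \<open>Distinctness is implicit: identifying a vertex of one arc with a vertex of the other
  makes a required arc coincide with a forbidden one.\<close>

definition end_arcs :: "'a rel \<Rightarrow> 'a \<Rightarrow> 'a \<Rightarrow> 'a \<Rightarrow> 'a \<Rightarrow> bool" where
  "end_arcs R a b c d \<longleftrightarrow> (b, a) \<in> R \<and> (c, d) \<in> R \<and> (b, c) \<notin> R \<and> (c, b) \<notin> R \<and>
     (a, c) \<notin> R \<and> (c, a) \<notin> R \<and> (a, d) \<notin> R \<and> (d, a) \<notin> R \<and> (b, d) \<notin> R \<and> (d, b) \<notin> R"

definition inner_vertex :: "'a rel \<Rightarrow> 'a \<Rightarrow> 'a \<Rightarrow> 'a \<Rightarrow> 'a \<Rightarrow> 'a \<Rightarrow> bool" where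
  "inner_vertex R a b c d v \<longleftrightarrow> v \<noteq> a \<and> v \<noteq> d \<and> (v, a) \<notin> R \<and> (a, v) \<notin> R \<and>
     (v, d) \<notin> R \<and> (d, v) \<notin> R \<and> (v, b) \<notin> R \<and> (v, c) \<notin> R"

text \<open>The condition is on the head only, so that walks can start in \<open>b\<close> and
  \<open>c\<close> but never return there.\<close>

definition inner_arcs :: "'a rel \<Rightarrow> 'a \<Rightarrow> 'a \<Rightarrow> 'a \<Rightarrow> 'a \<Rightarrow> 'a rel" where
  "inner_arcs R a b c d = {(u, v) \<in> R. inner_vertex R a b c d v}"

lemma end_arcs_sym: "end_arcs R a b c d \<longleftrightarrow> end_arcs R d c b a"
  by (auto simp: end_arcs_def)

lemma inner_arcs_sym: "inner_arcs R a b c d = inner_arcs R d c b a"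
  by (auto simp: inner_arcs_def inner_vertex_def)

section \<open>From two chordless paths to an induced subdivision\<close>

lemma fun_relpow: "(\<And>k. i \<le> k \<Longrightarrow> k < j \<Longrightarrow> (f k, f (Suc k)) \<in> E) \<Longrightarrow> i \<le> j \<Longrightarrow> (f i, f j) \<in> E ^^ (j - i)"
proof (induction j)
  case (Suc j)
  show ?case
  proof (cases "i = Suc j")
    case False
    then have "(f i, f j) \<in> E ^^ (j - i)" "(f j, f (Suc j)) \<in> E"
      using Suc by auto
    then show ?thesis using False Suc.prems(2) by (auto simp: Suc_diff_le)
  qed simp
qed simp

lemma set_vwalk_arcs_map_upt:
  "i \<le> j \<Longrightarrow> set (vwalk_arcs (map f [i..<Suc j])) = (\<lambda>k. (f k, f (Suc k))) ` {i..<j}"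
proof (induction rule: dec_induct)
  case (step j)
  have "map f [i..<Suc (Suc j)] = map f [i..<Suc j] @ [f (Suc j)]"
    using step.hyps by simp
  moreover have "map f [i..<Suc j] \<noteq> []" "last (map f [i..<Suc j]) = f j"
    using step.hyps by simp_all
  ultimately have "set (vwalk_arcs (map f [i..<Suc (Suc j)])) =
      insert (f j, f (Suc j)) ((\<lambda>k. (f k, f (Suc k))) ` {i..<j})"
    using step.IH set_vwalk_arcs_snoc[of "map f [i..<Suc j]" "f (Suc j)"] by simp
  then show ?case using step.hyps by (simp add: atLeastLessThanSuc del: upt_Suc)
qed simp

lemma subdivision_path_map:
  assumes "Q (f 0, f m) = map f [1..<m]" "0 < m"
  shows "subdivision_path Q (f 0, f m) = map f [0..<Suc m]"
proof -
  have "[0..<m] = 0 # [1..<m]" using assms(2) by (simp add: upt_conv_Cons)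
  then show ?thesis using assms(1) by (simp add: subdivision_path_def)
qed

text \<open>Stated for arbitrary vertex sequences, because it is applied to shifted tails of
  shortest paths. Vertices of a subdivision of \<open>A4_minus\<close> are natural numbers, so the
  work is to name the vertices of both sequences and to map the names back.\<close>

lemma contains_A4_minusI:
  fixes p q :: "nat \<Rightarrow> 'a"
  assumes wf: "pair_wf_digraph G" and pos: "0 < m" "0 < l"
    and inj: "inj_on p {..m}" "inj_on q {..l}" and meet: "p m = q l"
    and cross: "\<And>i j. i \<le> m \<Longrightarrow> j \<le> l \<Longrightarrow> p i = q j \<Longrightarrow> i = m \<and> j = l"
    and st: "s \<notin> p ` {..m} \<union> q ` {..l}" "t \<notin> p ` {..m} \<union> q ` {..l}" "s \<noteq> t"
    and W: "W = {s, t} \<union> p ` {..m} \<union> q ` {..l}"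
    and arcs: "parcs G \<inter> W \<times> W = {(p 0, s), (q 0, t)} \<union>
      (\<lambda>i. (p i, p (Suc i))) ` {..<m} \<union> (\<lambda>i. (q i, q (Suc i))) ` {..<l}" (is "_ = ?A")
  shows "contains_induced_subdivision G A4_minus"
proof -
  interpret pair_wf_digraph G by fact
  \<comment> \<open>The ends keep their names 2, 3 and 4, 3 in \<open>A4_minus\<close>. Internal
    vertices of \<open>p\<close> get the even numbers from 6 on, those of \<open>q\<close> the odd
    numbers from 7 on, so no names clash.\<close>
  define f :: "nat \<Rightarrow> nat" where "f i = (if i = 0 then 2 else if i = m then 3 else 2 * i + 4)" for i
  define g :: "nat \<Rightarrow> nat" where "g i = (if i = 0 then 4 else if i = l then 3 else 2 * i + 5)" for i
  define h :: "nat \<Rightarrow> 'a" where "h v =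
    (if v = 1 then s else if v = 2 then p 0 else if v = 3 then p m else if v = 4 then q 0 else
     if v = 5 then t else if even v then p ((v - 4) div 2) else q ((v - 5) div 2))" for v
  define Q :: "nat \<times> nat \<Rightarrow> nat list" where "Q e =
    (if e = (2, 3) then map f [1..<m] else if e = (4, 3) then map g [1..<l] else [])" for e
  define H where "H = \<lparr>pverts = {1, 5} \<union> f ` {..m} \<union> g ` {..l}, parcs = {(2, 1), (4, 5)} \<union>
      (\<lambda>i. (f i, f (Suc i))) ` {..<m} \<union> (\<lambda>i. (g i, g (Suc i))) ` {..<l}\<rparr>"
  have h15: "h 1 = s" "h 5 = t" by (simp_all add: h_def)
  have hf: "h (f i) = p i" if "i \<le> m" for i
    using that pos by (auto simp: h_def f_def)
  have hg: "h (g i) = q i" if "i \<le> l" for i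
    using that pos meet by (auto simp: h_def g_def)
  have f0: "f 0 = 2" "f m = 3" and g0: "g 0 = 4" "g l = 3"
    using pos by (auto simp: f_def g_def)
  have V: "pverts H = {1, 5} \<union> f ` {..m} \<union> g ` {..l}" and A: "parcs H = {(2, 1), (4, 5)} \<union>
      (\<lambda>i. (f i, f (Suc i))) ` {..<m} \<union> (\<lambda>i. (g i, g (Suc i))) ` {..<l}"
    by (simp_all add: H_def)
  have "is_subdivision_of H A4_minus"
    unfolding is_subdivision_of_def
  proof (intro exI[of _ Q] conjI)
    have Qs: "Q (2, 1) = []" "Q (4, 5) = []" "Q (2, 3) = map f [1..<m]" "Q (4, 3) = map g [1..<l]"
      by (simp_all add: Q_def)
    have fD: "f ` {1..<m} \<inter> {1, 2, 3, 4, 5} = {}" "g ` {1..<l} \<inter> {1, 2, 3, 4, 5} = {}"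
      by (auto simp: f_def g_def)
    have fg: "f ` {1..<m} \<inter> g ` {1..<l} = {}"
      by (auto simp: f_def g_def) presburger+
    show "\<forall>e\<in>parcs A4_minus. distinct (Q e) \<and> set (Q e) \<inter> pverts A4_minus = {}"
      using fD by (auto simp: A4_minus_def Qs distinct_map inj_on_def f_def g_def simp del: One_nat_def)
    show "\<forall>e\<in>parcs A4_minus. \<forall>e'\<in>parcs A4_minus. e \<noteq> e' \<longrightarrow> set (Q e) \<inter> set (Q e') = {}"
      using fg by (auto simp: A4_minus_def Qs simp del: One_nat_def)
    have split: "{..k} = {0, k} \<union> {1..<k}" for k :: nat by auto
    show "pverts H = pverts A4_minus \<union> (\<Union>e\<in>parcs A4_minus. set (Q e))"
      unfolding V split[of m] split[of l] image_Un image_insert image_empty f0 g0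
      by (auto simp: A4_minus_def Qs simp del: One_nat_def)
    have sp: "subdivision_path Q (2, 3) = map f [0..<Suc m]" "subdivision_path Q (4, 3) = map g [0..<Suc l]"
      using subdivision_path_map[of Q f m] subdivision_path_map[of Q g l] pos Qs by (simp_all add: f0 g0 del: upt_Suc)
    have "(\<Union>e\<in>parcs A4_minus. set (vwalk_arcs (subdivision_path Q e))) =
      set (vwalk_arcs (subdivision_path Q (2, 1))) \<union> set (vwalk_arcs (subdivision_path Q (2, 3))) \<union>
      set (vwalk_arcs (subdivision_path Q (4, 3))) \<union> set (vwalk_arcs (subdivision_path Q (4, 5)))"
      by (simp add: A4_minus_def Un_assoc)
    also have "\<dots> = parcs H"
      unfolding sp A set_vwalk_arcs_map_upt[OF le0]
      by (auto simp: subdivision_path_def Qs simp del: One_nat_def)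
    finally show "parcs H = (\<Union>e\<in>parcs A4_minus. set (vwalk_arcs (subdivision_path Q e)))" ..
  qed
  moreover have "pair_wf_digraph H"
  proof
    have "2 \<in> f ` {..m}" "4 \<in> g ` {..l}" using f0 g0 by force+
    then show "fst e \<in> pverts H" "snd e \<in> pverts H" if "e \<in> parcs H" for e
      using that unfolding V A by auto
  qed
  moreover have "inj_on h (pverts H)"
  proof (rule inj_onI)
    \<comment> \<open>The sequences coincide only at their last indices, where both names are
      3.\<close>
    have f_g: "f i = g j" if "p i = q j" "i \<le> m" "j \<le> l" for i j
      using cross[of i j] that f0 g0 by auto
    fix x y assume xy: "x \<in> pverts H" "y \<in> pverts H" "h x = h y"
    then show "x = y"
      using h15 hf hg st f_g inj unfolding V
      by (elim UnE insertE imageE; simp) (metis atMost_iff inj_onD image_eqI)+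
  qed
  moreover have hV: "h ` pverts H = W"
  proof -
    have "h ` f ` {..m} = p ` {..m}" "h ` g ` {..l} = q ` {..l}"
      using hf hg by (force simp: image_image)+
    then show ?thesis using h15 unfolding V W by (simp add: image_Un del: One_nat_def)
  qed
  moreover have "W \<subseteq> pverts G"
  proof -
    have "?A \<subseteq> parcs G" using arcs by blast
    moreover have "(p i, p (Suc i)) \<in> ?A" if "i < m" for i using that by auto
    moreover have "(q i, q (Suc i)) \<in> ?A" if "i < l" for i using that by auto
    ultimately have A: "(p 0, s) \<in> parcs G" "(q 0, t) \<in> parcs G"
        "i < m \<Longrightarrow> (p i, p (Suc i)) \<in> parcs G" "i < l \<Longrightarrow> (q i, q (Suc i)) \<in> parcs G" for i
      by blast+
    have "p i \<in> pverts G" if "i \<le> m" for i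
      using A(1) A(3)[of "i - 1"] that by (cases i) (auto dest: wellformed')
    moreover have "q i \<in> pverts G" if "i \<le> l" for i
      using A(2) A(4)[of "i - 1"] that by (cases i) (auto dest: wellformed')
    ultimately show ?thesis using A(1,2) unfolding W by (auto dest: wellformed')
  qed
  moreover have "map_prod h h ` parcs H = ?A"
  proof -
    have "map_prod h h ` parcs H = {(h 2, h 1), (h 4, h 5)} \<union>
      (\<lambda>i. (h (f i), h (f (Suc i)))) ` {..<m} \<union> (\<lambda>i. (h (g i), h (g (Suc i)))) ` {..<l}"
      unfolding A by (simp add: image_Un image_image)
    also have "(\<lambda>i. (h (f i), h (f (Suc i)))) ` {..<m} = (\<lambda>i. (p i, p (Suc i))) ` {..<m}"
      by (rule image_cong) (auto simp: hf)
    also have "(\<lambda>i. (h (g i), h (g (Suc i)))) ` {..<l} = (\<lambda>i. (q i, q (Suc i))) ` {..<l}"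
      by (rule image_cong) (auto simp: hg)
    finally show ?thesis using h15 hf[of 0] hg[of 0] f0 g0 by (simp del: One_nat_def)
  qed
  ultimately show ?thesis
    unfolding contains_induced_subdivision_iff using wf arcs by metis
qed

section \<open>From an induced subdivision to reachability\<close>

lemma set_vwalk_arcs_subset: "set (vwalk_arcs xs) \<subseteq> set xs \<times> set xs"
  by (induction xs rule: vwalk_arcs.induct) auto

text \<open>The head could be the target of an arc only by occurring a second time. Applied to the
  four paths, this makes 2 and 4 sources.\<close>

lemma no_arc_to_hd: "distinct xs \<Longrightarrow> (u, hd xs) \<notin> set (vwalk_arcs xs)"
proof (cases xs)
  case (Cons x ys)
  assume "distinct xs"
  then show ?thesis using set_vwalk_arcs_subset[of ys] Cons by (cases ys) auto
qed simp

lemma hd_reaches: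
  assumes "set (vwalk_arcs (x # xs)) \<subseteq> R" "y \<in> set xs"
  shows "(x, y) \<in> {(u, v) \<in> R. v \<in> set xs}\<^sup>*"
  using assms
proof (induction xs arbitrary: x)
  case (Cons z zs)
  have z: "(x, z) \<in> {(u, v) \<in> R. v \<in> set (z # zs)}" using Cons.prems by simp
  have "(z, y) \<in> {(u, v) \<in> R. v \<in> set (z # zs)}\<^sup>*"
  proof (cases "y = z")
    case False
    then have "(z, y) \<in> {(u, v) \<in> R. v \<in> set zs}\<^sup>*" using Cons by simp
    then show ?thesis by (rule subsetD[OF rtrancl_mono, rotated]) auto
  qed simp
  then show ?case using z by (rule converse_rtrancl_into_rtrancl[rotated])
qed simp

text \<open>The outer paths are cut after one arc: \<open>a\<close> and \<open>d\<close> are the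
  images of the successors of 2 and 4 on them, \<open>b\<close> and \<open>c\<close> the images of 2
  and 4, and \<open>x\<close> that of 3. Since the copy is induced, every forbidden arc reduces to
  an arc missing in \<open>H\<close>.\<close>

lemma contains_A4_minusE:
  assumes "contains_induced_subdivision G A4_minus"
  obtains a b c d x where "end_arcs (parcs G) a b c d" "{a, b, c, d, x} \<subseteq> pverts G"
    "(b, x) \<in> (inner_arcs (parcs G) a b c d)\<^sup>*" "(c, x) \<in> (inner_arcs (parcs G) a b c d)\<^sup>*"
proof -
  obtain H h where sub: "is_subdivision_of H A4_minus" and wfH: "pair_wf_digraph H"
    and h: "inj_on h (pverts H)" "h ` pverts H \<subseteq> pverts G"
    and eq: "map_prod h h ` parcs H = parcs G \<inter> h ` pverts H \<times> h ` pverts H"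
    using assms unfolding contains_induced_subdivision_iff by auto
  interpret H: pair_wf_digraph H by fact
  define D :: "(nat \<times> nat) set" where "D = {(2, 1), (2, 3), (4, 3), (4, 5)}"
  have D: "parcs A4_minus = D" "pverts A4_minus = {1, 2, 3, 4, 5}" by (simp_all add: A4_minus_def D_def)
  obtain Q where Q: "\<And>e. e \<in> D \<Longrightarrow> distinct (Q e) \<and> set (Q e) \<inter> {1, 2, 3, 4, 5} = {}"
      "\<And>e e'. e \<in> D \<Longrightarrow> e' \<in> D \<Longrightarrow> e \<noteq> e' \<Longrightarrow> set (Q e) \<inter> set (Q e') = {}"
    and V: "pverts H = {1, 2, 3, 4, 5} \<union> (\<Union>e \<in> D. set (Q e))"
    and A: "parcs H = (\<Union>e \<in> D. set (vwalk_arcs (subdivision_path Q e)))"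
    using sub unfolding is_subdivision_of_def D by metis
  have arc_iff: "(h u, h v) \<in> parcs G \<longleftrightarrow> (u, v) \<in> parcs H" if "u \<in> pverts H" "v \<in> pverts H" for u v
  proof
    assume "(h u, h v) \<in> parcs G"
    then have "(h u, h v) \<in> map_prod h h ` parcs H" using that unfolding eq by simp
    then obtain u' v' where *: "(u', v') \<in> parcs H" "h u = h u'" "h v = h v'" by auto
    then have "u = u'" "v = v'" using h(1) that H.wellformed' by (auto dest: inj_onD)
    then show "(u, v) \<in> parcs H" using * by simp
  next
    assume "(u, v) \<in> parcs H"
    then have "map_prod h h (u, v) \<in> map_prod h h ` parcs H" by (rule imageI)
    then show "(h u, h v) \<in> parcs G" unfolding eq by simp
  qed
  define P where "P e = set (subdivision_path Q e)" for e
  have P: "P e = insert (fst e) (insert (snd e) (set (Q e)))" for e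
    by (auto simp: P_def subdivision_path_def)
  \<comment> \<open>Every arc of \<open>H\<close> stays on one of the four paths and does not enter
    its start, so non-adjacency follows from knowing on which paths two vertices lie.\<close>
  have arcD: "\<exists>e \<in> D. u \<in> P e \<and> v \<in> P e \<and> v \<noteq> fst e" if uv: "(u, v) \<in> parcs H" for u v
  proof -
    obtain e where e: "e \<in> D" "(u, v) \<in> set (vwalk_arcs (subdivision_path Q e))"
      using uv unfolding A by blast
    have "distinct (subdivision_path Q e)"
      using Q(1)[OF e(1)] e(1) by (auto simp: subdivision_path_def D_def)
    then have "v \<noteq> fst e"
      using no_arc_to_hd[of "subdivision_path Q e" u] e(2) by (auto simp: subdivision_path_def)
    moreover have "u \<in> P e" "v \<in> P e"
      using e(2) set_vwalk_arcs_subset[of "subdivision_path Q e"] unfolding P_def by auto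
    ultimately show ?thesis using e(1) by blast
  qed
  then have no_arc: "(u, v) \<notin> parcs H"
    if "u \<in> P (2, 1) \<Longrightarrow> v \<in> P (2, 1) \<Longrightarrow> v = 2" "u \<in> P (2, 3) \<Longrightarrow> v \<in> P (2, 3) \<Longrightarrow> v = 2"
      "u \<in> P (4, 3) \<Longrightarrow> v \<in> P (4, 3) \<Longrightarrow> v = 4" "u \<in> P (4, 5) \<Longrightarrow> v \<in> P (4, 5) \<Longrightarrow> v = 4" for u v
    using that unfolding D_def by fastforce
  have D_mem: "(2, 1) \<in> D" "(2, 3) \<in> D" "(4, 3) \<in> D" "(4, 5) \<in> D" by (simp_all add: D_def)
  \<comment> \<open>Appending the end of the arc covers the case that the arc is not
    subdivided.\<close>
  define first where "first e = hd (Q e @ [snd e])" for e :: "nat \<times> nat"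
  have first: "first e \<in> insert (snd e) (set (Q e))" for e
    by (cases "Q e") (auto simp: first_def)
  have first_arc: "(fst e, first e) \<in> parcs H" if "e \<in> D" for e
  proof -
    have "(fst e, first e) \<in> set (vwalk_arcs (subdivision_path Q e))"
      by (simp add: subdivision_path_def first_def)
    with that show ?thesis unfolding A by (rule UN_I)
  qed
  define a' d' where "a' = first (2, 1)" and "d' = first (4, 5)"
  have a': "a' \<in> insert 1 (set (Q (2, 1)))" and d': "d' \<in> insert 5 (set (Q (4, 5)))"
    using first[of "(2, 1)"] first[of "(4, 5)"] by (auto simp: a'_def d'_def)
  have Q15: "set (Q (2, 1)) \<inter> {1, 2, 3, 4, 5} = {}" "set (Q (2, 3)) \<inter> {1, 2, 3, 4, 5} = {}"
      "set (Q (4, 3)) \<inter> {1, 2, 3, 4, 5} = {}" "set (Q (4, 5)) \<inter> {1, 2, 3, 4, 5} = {}"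
    using Q(1) D_mem by blast+
  have Qd: "set (Q (2, 1)) \<inter> set (Q (2, 3)) = {}" "set (Q (2, 1)) \<inter> set (Q (4, 3)) = {}"
      "set (Q (2, 1)) \<inter> set (Q (4, 5)) = {}" "set (Q (2, 3)) \<inter> set (Q (4, 3)) = {}"
      "set (Q (2, 3)) \<inter> set (Q (4, 5)) = {}" "set (Q (4, 3)) \<inter> set (Q (4, 5)) = {}"
    by (rule Q(2); simp add: D_def)+
  have inV: "a' \<in> pverts H" "d' \<in> pverts H" "2 \<in> pverts H" "3 \<in> pverts H" "4 \<in> pverts H"
    using a' d' D_mem unfolding V by auto
  have nP: "a' \<notin> P (2, 3)" "a' \<notin> P (4, 3)" "a' \<notin> P (4, 5)"
      "d' \<notin> P (2, 1)" "d' \<notin> P (2, 3)" "d' \<notin> P (4, 3)"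
      "2 \<notin> P (4, 3)" "2 \<notin> P (4, 5)" "4 \<notin> P (2, 1)" "4 \<notin> P (2, 3)"
    using a' d' Q15 Qd unfolding P by auto
  have ends: "end_arcs (parcs G) (h a') (h 2) (h 4) (h d')"
    unfolding end_arcs_def arc_iff[OF inV(1) inV(2)] arc_iff[OF inV(2) inV(1)]
      arc_iff[OF inV(3) inV(1)] arc_iff[OF inV(5) inV(2)] arc_iff[OF inV(3) inV(5)] arc_iff[OF inV(5) inV(3)]
      arc_iff[OF inV(1) inV(5)] arc_iff[OF inV(5) inV(1)] arc_iff[OF inV(3) inV(2)] arc_iff[OF inV(2) inV(3)]
  proof (intro conjI)
    show "(2, a') \<in> parcs H" "(4, d') \<in> parcs H"
      using first_arc[of "(2, 1)"] first_arc[of "(4, 5)"] D_mem by (simp_all add: a'_def d'_def)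
  qed (rule no_arc; simp add: nP del: One_nat_def)+
  have inner: "inner_vertex (parcs G) (h a') (h 2) (h 4) (h d') (h v)"
    if v: "v \<in> set (Q (2, 3)) \<union> set (Q (4, 3)) \<union> {3}" for v
  proof -
    have vV: "v \<in> pverts H" using v D_mem unfolding V by blast
    have nv: "v \<notin> P (2, 1)" "v \<notin> P (4, 5)"
      using v Q15 Qd unfolding P by auto
    have ne: "v \<noteq> a'" "v \<noteq> d'"
      using v nP unfolding P by auto
    then have "h v \<noteq> h a'" "h v \<noteq> h d'"
      using h(1) vV inV by (auto dest: inj_onD)
    moreover have "(v, a') \<notin> parcs H" "(a', v) \<notin> parcs H" "(v, d') \<notin> parcs H" "(d', v) \<notin> parcs H"
      by (rule no_arc; simp add: nP nv del: One_nat_def)+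
    moreover have "(v, 2) \<notin> parcs H" "(v, 4) \<notin> parcs H"
      by (rule no_arc; simp add: nP nv del: One_nat_def)+
    ultimately show ?thesis
      unfolding inner_vertex_def using arc_iff vV inV by simp
  qed
  have reach: "(h (fst e), h 3) \<in> (inner_arcs (parcs G) (h a') (h 2) (h 4) (h d'))\<^sup>*"
    if e: "e \<in> {(2, 3), (4, 3)}" for e :: "nat \<times> nat"
  proof -
    have "(fst e, 3) \<in> {(u, v) \<in> parcs H. v \<in> set (Q e @ [3])}\<^sup>*"
    proof (rule hd_reaches)
      show "set (vwalk_arcs (fst e # Q e @ [3])) \<subseteq> parcs H"
        using e D_mem unfolding A subdivision_path_def by auto
    qed simp
    then show ?thesis
    proof (induction rule: rtrancl_induct)
      case (step u v)
      then have "inner_vertex (parcs G) (h a') (h 2) (h 4) (h d') (h v)"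
        using e by (intro inner) auto
      moreover have "(h u, h v) \<in> parcs G"
        using step.hyps(2) arc_iff H.wellformed' by blast
      ultimately have "(h u, h v) \<in> inner_arcs (parcs G) (h a') (h 2) (h 4) (h d')"
        by (simp add: inner_arcs_def)
      with step.IH show ?case by (rule rtrancl_into_rtrancl)
    qed simp
  qed
  show thesis
    using that[OF ends, of "h 3"] reach[of "(2, 3)"] reach[of "(4, 3)"] h(2) inV by auto
qed

section \<open>Pairs of paths of minimal total length and their tails\<close>

lemma image_shift_atMost:
  fixes n N :: nat
  assumes "n < N"
  shows "(\<lambda>i. f (i + n)) ` {..N - n} = f ` {n..N}"
proof -
  have "(\<lambda>i. i + n) ` {..N - n} = {n..N}"
    using assms image_add_atLeastAtMost'[of n 0 "N - n"] by (simp add: atMost_atLeast0 add.commute)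
  then show ?thesis by (metis image_image)
qed

lemma image_shift_lessThan:
  fixes n N :: nat
  assumes "n < N"
  shows "(\<lambda>i. f (i + n)) ` {..<N - n} = f ` {n..<N}"
proof -
  have "(\<lambda>i. i + n) ` {..<N - n} = {n..<N}"
    using assms image_add_atLeastLessThan'[of n 0 "N - n"] by (simp add: lessThan_atLeast0 add.commute)
  then show ?thesis by (metis image_image)
qed

text \<open>\<open>minimal\<close> ranges over every common vertex \<open>y\<close>, not only over
  ways to reach \<open>p m\<close>. This single measure controls both the chords of either path and
  the contacts between the paths.\<close>

locale shortest_meeting =
  fixes R :: "'a rel" and a b c d :: 'a and p q :: "nat \<Rightarrow> 'a" and m l :: nat
  assumes asym: "(u, v) \<in> R \<Longrightarrow> (v, u) \<notin> R"
    and ends: "end_arcs R a b c d"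
    and p0: "p 0 = b" and q0: "q 0 = c"
    and p_step: "i < m \<Longrightarrow> (p i, p (Suc i)) \<in> inner_arcs R a b c d"
    and q_step: "i < l \<Longrightarrow> (q i, q (Suc i)) \<in> inner_arcs R a b c d"
    and meet: "p m = q l"
    and minimal: "(b, y) \<in> inner_arcs R a b c d ^^ i \<Longrightarrow> (c, y) \<in> inner_arcs R a b c d ^^ j \<Longrightarrow> m + l \<le> i + j"
begin

text \<open>The pattern has a symmetry exchanging its two sides; through this instance every fact
  about \<open>p\<close> also holds for \<open>q\<close>.\<close>

lemma reflected: "shortest_meeting R d c b a q p l m"
proof
  fix y i j
  assume "(c, y) \<in> inner_arcs R d c b a ^^ i" "(b, y) \<in> inner_arcs R d c b a ^^ j"
  then show "l + m \<le> i + j" using minimal[of y j i] by (simp add: inner_arcs_sym[of R d c b a])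
qed (use asym ends p0 q0 p_step q_step meet in \<open>simp_all add: inner_arcs_sym[of R d c b a] end_arcs_sym[of R d c b a]\<close>)

abbreviation "E \<equiv> inner_arcs R a b c d"

lemma p_relpow: "i \<le> j \<Longrightarrow> j \<le> m \<Longrightarrow> (p i, p j) \<in> E ^^ (j - i)"
  by (rule fun_relpow) (auto intro: p_step)

lemma q_relpow: "i \<le> j \<Longrightarrow> j \<le> l \<Longrightarrow> (q i, q j) \<in> E ^^ (j - i)"
  by (rule fun_relpow) (auto intro: q_step)

lemma b_relpow: "i \<le> m \<Longrightarrow> (b, p i) \<in> E ^^ i"
  using p_relpow[of 0 i] p0 by simp

lemma c_relpow: "i \<le> l \<Longrightarrow> (c, q i) \<in> E ^^ i"
  using q_relpow[of 0 i] q0 by simp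

lemma inner_p: "0 < i \<Longrightarrow> i \<le> m \<Longrightarrow> inner_vertex R a b c d (p i)"
  using p_step[of "i - 1"] by (auto simp: inner_arcs_def)

text \<open>Otherwise \<open>b\<close> is the meeting vertex; differing from \<open>c\<close>, it is
  entered by a step of \<open>q\<close>, although its arc to \<open>a\<close> keeps it from being
  inner.\<close>

lemma m_pos: "0 < m"
proof (rule ccontr)
  assume "\<not> 0 < m"
  then have eq: "b = q l" using meet p0 by simp
  have "b \<noteq> c" using ends by (auto simp: end_arcs_def)
  then have "0 < l" using eq q0 by (cases l) auto
  then have "inner_vertex R a b c d b"
    using q_step[of "l - 1"] eq by (auto simp: inner_arcs_def)
  then show False using ends by (auto simp: inner_vertex_def end_arcs_def)
qed

text \<open>A shorter walk to \<open>p j\<close>, continued along \<open>p\<close>, would meet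
  \<open>q\<close> at the same vertex with a smaller total.\<close>

lemma shortcut_p:
  assumes "(b, p j) \<in> E ^^ i" "j \<le> m"
  shows "j \<le> i"
proof -
  have "(b, p m) \<in> E ^^ (i + (m - j))"
    using relpow_trans[OF assms(1) p_relpow[of j m]] assms(2) by simp
  from minimal[OF this, of l] show ?thesis using c_relpow[of l] meet assms(2) by simp
qed

lemma p_distinct: "i < j \<Longrightarrow> j \<le> m \<Longrightarrow> p i \<noteq> p j"
  using shortcut_p[of j i] b_relpow[of i] by auto

text \<open>For \<open>0 < j\<close> the target is an inner vertex, so the arc is a step of
  \<open>E\<close> and \<open>p j\<close> is reached after \<open>i + 1\<close> steps. Index 0 is
  different because \<open>b\<close> is not inner.\<close>

lemma arc_from_p:
  assumes "(p i, p j) \<in> R" "i \<le> m" "j \<le> m" "0 < j"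
  shows "j \<le> Suc i"
proof (rule shortcut_p)
  have "(p i, p j) \<in> E" using inner_p[of j] assms by (auto simp: inner_arcs_def)
  then show "(b, p j) \<in> E ^^ Suc i" using b_relpow[OF assms(2)] by auto
qed fact

lemma loopfree: "(u, u) \<notin> R"
  using asym by blast

lemma no_arc_to_b: "i \<le> m \<Longrightarrow> (p i, b) \<notin> R"
  using inner_p[of i] loopfree p0 by (cases "i = 0") (auto simp: inner_vertex_def)

lemma no_arc_to_c: "i \<le> m \<Longrightarrow> (p i, c) \<notin> R"
  using inner_p[of i] ends p0 by (cases "i = 0") (auto simp: inner_vertex_def end_arcs_def)

lemma cross_disjoint:
  assumes "p i = q j" "i \<le> m" "j \<le> l"
  shows "i = m" "j = l"
  using minimal[of "p i" i j] b_relpow[of i] c_relpow[of j] assms by auto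

text \<open>With such an arc \<open>c\<close> would reach \<open>p i\<close> in \<open>l + 1\<close>
  steps. Minimality leaves only \<open>i = m\<close>, a loop, and \<open>i = m - 1\<close>, the
  reverse of the last arc of \<open>p\<close>.\<close>

lemma no_arc_from_meet:
  assumes "i \<le> m"
  shows "(p m, p i) \<notin> R"
proof
  assume *: "(p m, p i) \<in> R"
  then have "0 < i" using no_arc_to_b[of m] p0 by (cases i) auto
  then have "(p m, p i) \<in> E" using * inner_p assms by (auto simp: inner_arcs_def)
  then have "(c, p i) \<in> E ^^ Suc l" using c_relpow[of l] meet by auto
  then have "m \<le> Suc i" using minimal b_relpow[OF assms] by fastforce
  then consider "i = m" | "m = Suc i" using assms by linarith
  then show False
  proof cases
    case 1
    then show ?thesis using * loopfree by auto
  next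
    case 2
    then show ?thesis using * asym p_step[of i] by (auto simp: inner_arcs_def)
  qed
qed

lemma inner_q: "0 < j \<Longrightarrow> j \<le> l \<Longrightarrow> inner_vertex R a b c d (q j)"
  using q_step[of "j - 1"] by (auto simp: inner_arcs_def)

text \<open>A cross arc makes \<open>q j\<close> a meeting vertex of total \<open>i + 1 + j\<close>.
  As arcs leaving the meeting vertex are excluded, \<open>i < m\<close>, and minimality leaves only
  the last arc of \<open>p\<close> itself.\<close>

lemma no_cross_arc:
  assumes "(p i, q j) \<in> R" "i \<le> m" "j \<le> l"
  shows "j = l" "Suc i = m"
proof -
  have "0 < j" using no_arc_to_c[OF assms(2)] assms(1) q0 by (cases j) auto
  \<comment> \<open>\<open>q j\<close> is inner because \<open>q\<close> enters it, so the cross arc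
    is a step of \<open>E\<close> as well.\<close>
  then have "(q (j - 1), q j) \<in> E" using q_step[of "j - 1"] assms(3) by simp
  then have E: "(p i, q j) \<in> E" using assms(1) by (auto simp: inner_arcs_def)
  then have "(b, q j) \<in> E ^^ Suc i" using b_relpow[OF assms(2)] by auto
  then have le: "m + l \<le> Suc i + j" using minimal c_relpow[OF assms(3)] by fastforce
  have "i \<noteq> m"
  proof
    assume i: "i = m"
    have "(q l, q j) \<notin> R"
      using shortest_meeting.no_arc_from_meet[OF reflected assms(3)] .
    then show False using assms(1) i meet by simp
  qed
  then show "j = l" "Suc i = m" using le assms by auto
qed

text \<open>A shortest path has no forward chords, but it may have backward ones. If \<open>p j\<close> is the last
  vertex with a backward chord, then that chord is a new end arc for the rest of the path.\<close>

lemma induced_end: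
  obtains k s where "k < m" "(p k, s) \<in> R" "s \<in> insert a (p ` {..<k})" "\<And>i. k \<le> i \<Longrightarrow> i \<le> m \<Longrightarrow> s \<noteq> p i"
    "\<And>i. k \<le> i \<Longrightarrow> i \<le> m \<Longrightarrow> (s, p i) \<notin> R" "\<And>i. k < i \<Longrightarrow> i \<le> m \<Longrightarrow> (p i, s) \<notin> R"
    "\<And>i j. k \<le> i \<Longrightarrow> i \<le> m \<Longrightarrow> k \<le> j \<Longrightarrow> j \<le> m \<Longrightarrow> (p i, p j) \<in> R \<longleftrightarrow> j = Suc i"
proof -
  have arcs: "(p i, p j) \<in> R \<longleftrightarrow> j = Suc i"
    if k: "\<And>i j. k < j \<Longrightarrow> j < m \<Longrightarrow> i < j \<Longrightarrow> (p j, p i) \<notin> R" and ij: "k \<le> i" "k \<le> j" "i \<le> m" "j \<le> m"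
    for k i j
  proof
    assume R: "(p i, p j) \<in> R"
    then have "i \<noteq> m" using no_arc_from_meet[OF ij(4)] by auto
    then have "i \<le> j" using k[of i j] R ij by (cases "i \<le> j") auto
    moreover have "i \<noteq> j" using R loopfree by auto
    ultimately show "j = Suc i" using arc_from_p[OF R] ij by auto
  next
    assume "j = Suc i"
    then show "(p i, p j) \<in> R" using p_step[of i] ij by (auto simp: inner_arcs_def)
  qed
  \<comment> \<open>Indices from which backward chords start; \<open>m\<close> is left out because
    the meeting vertex has no arc to the path.\<close>
  define B where "B = {j. j < m \<and> (\<exists>i<j. (p j, p i) \<in> R)}"
  show ?thesis
  proof (cases "B = {}")
    case True
    show ?thesis
    proof (rule that[of 0 a])
      have adj: "a \<noteq> p i" "(a, p i) \<notin> R" "0 < i \<longrightarrow> (p i, a) \<notin> R" if "i \<le> m" for i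
        using inner_p[of i] ends p0 that loopfree asym[of b a]
        by (cases "i = 0"; auto simp: inner_vertex_def end_arcs_def)+
      then show "a \<noteq> p i" "(a, p i) \<notin> R" "0 < i \<Longrightarrow> (p i, a) \<notin> R" if "i \<le> m" for i using that by auto
      show "(p i, p j) \<in> R \<longleftrightarrow> j = Suc i" if "0 \<le> i" "i \<le> m" "0 \<le> j" "j \<le> m" for i j
        using arcs[of 0 i j] True that by (auto simp: B_def)
    qed (use m_pos ends p0 in \<open>auto simp: end_arcs_def\<close>)
  next
    case False
    have fin: "finite B" by (auto simp: B_def)
    \<comment> \<open>Maximality serves twice: the tail from \<open>k\<close> on has no backward
      chord, and no later vertex has an arc to the new end.\<close>
    define k where "k = Max B"
    have "k \<in> B" unfolding k_def using Max_in[OF fin False] .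
    then obtain i0 where k: "k < m" "i0 < k" "(p k, p i0) \<in> R" by (auto simp: B_def)
    have max: "j \<le> k" if "j \<in> B" for j
      unfolding k_def using Max_ge[OF fin that] .
    have last: "(p j, p i) \<notin> R" if "k < j" "j < m" "i < j" for i j
      using max[of j] that by (auto simp: B_def)
    \<comment> \<open>A chord to the direct predecessor would close a 2-cycle. Hence the new end
      lies at least two steps back and, having no forward chords, sends no arc into the
      tail.\<close>
    have i0: "Suc i0 \<noteq> k"
    proof
      assume "Suc i0 = k"
      then have "(p i0, p k) \<in> R" using p_step[of i0] k by (auto simp: inner_arcs_def)
      then show False using asym k(3) by blast
    qed
    show ?thesis
    proof (rule that[of k "p i0"])
      fix i assume i: "k \<le> i" "i \<le> m"
      then show "p i0 \<noteq> p i" using p_distinct[of i0 i] k by auto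
      show "(p i0, p i) \<notin> R"
        using arc_from_p[of i0 i] i k i0 by auto
    next
      fix i assume i: "k < i" "i \<le> m"
      show "(p i, p i0) \<notin> R"
        using last[of i i0] i k no_arc_from_meet[of i0] by (cases "i = m") auto
    qed (use k arcs[OF last] in auto)
  qed
qed

text \<open>A new end is \<open>a\<close> or a discarded vertex of \<open>p\<close>, at an index
  below \<open>m - 1\<close>. Contacts with \<open>q\<close> involve only the indices
  \<open>m - 1\<close> and \<open>m\<close>, so trimming one side does not affect the other.\<close>

lemma separated:
  assumes "k < m" "s \<in> insert a (p ` {..<k})" "t \<in> insert d (q ` {..l})"
  shows "s \<noteq> t" "(s, t) \<notin> R" "(t, s) \<notin> R"
proof -
  have ad: "a \<noteq> d" "(a, d) \<notin> R" "(d, a) \<notin> R"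
    using ends by (auto simp: end_arcs_def)
  have aq: "a \<noteq> q j \<and> (a, q j) \<notin> R \<and> (q j, a) \<notin> R" if "j \<le> l" for j
    using inner_q[of j] that ends q0 by (cases "j = 0") (auto simp: inner_vertex_def end_arcs_def)
  have pd: "p i \<noteq> d \<and> (p i, d) \<notin> R \<and> (d, p i) \<notin> R" if "i < m" for i
    using inner_p[of i] that ends p0 by (cases "i = 0") (auto simp: inner_vertex_def end_arcs_def)
  have pq: "p i \<noteq> q j \<and> (p i, q j) \<notin> R \<and> (q j, p i) \<notin> R" if "i < k" "j \<le> l" for i j
  proof -
    have i: "i \<le> m" "i \<noteq> m" "Suc i \<noteq> m" using that assms(1) by auto
    show ?thesis
      using cross_disjoint(1)[OF _ i(1) that(2)] no_cross_arc(2)[OF _ i(1) that(2)]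
        shortest_meeting.no_cross_arc(1)[OF reflected _ that(2) i(1)] i by blast
  qed
  have "s \<noteq> t \<and> (s, t) \<notin> R \<and> (t, s) \<notin> R"
    using assms ad aq pd pq by (elim insertE imageE; simp)
  then show "s \<noteq> t" "(s, t) \<notin> R" "(t, s) \<notin> R" by blast+
qed

text \<open>The sides are trimmed independently: each keeps a tail up to the meeting vertex and gets
  an end of its own. The induced arcs are then compared block by block over \<open>s\<close>,
  \<open>t\<close> and the two tails.\<close>

lemma contains_A4_minus:
  assumes wf: "pair_wf_digraph G" and R: "R = parcs G"
  shows "contains_induced_subdivision G A4_minus"
proof -
  interpret r: shortest_meeting R d c b a q p l m by (rule reflected)
  obtain k s where k: "k < m" "(p k, s) \<in> R" "s \<in> insert a (p ` {..<k})"
    and s: "\<And>i. k \<le> i \<Longrightarrow> i \<le> m \<Longrightarrow> s \<noteq> p i"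
      "\<And>i. k \<le> i \<Longrightarrow> i \<le> m \<Longrightarrow> (s, p i) \<notin> R" "\<And>i. k < i \<Longrightarrow> i \<le> m \<Longrightarrow> (p i, s) \<notin> R"
    and p: "\<And>i j. k \<le> i \<Longrightarrow> i \<le> m \<Longrightarrow> k \<le> j \<Longrightarrow> j \<le> m \<Longrightarrow> (p i, p j) \<in> R \<longleftrightarrow> j = Suc i"
    using induced_end by blast
  obtain k' t where k': "k' < l" "(q k', t) \<in> R" "t \<in> insert d (q ` {..<k'})"
    and t: "\<And>i. k' \<le> i \<Longrightarrow> i \<le> l \<Longrightarrow> t \<noteq> q i"
      "\<And>i. k' \<le> i \<Longrightarrow> i \<le> l \<Longrightarrow> (t, q i) \<notin> R" "\<And>i. k' < i \<Longrightarrow> i \<le> l \<Longrightarrow> (q i, t) \<notin> R"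
    and q: "\<And>i j. k' \<le> i \<Longrightarrow> i \<le> l \<Longrightarrow> k' \<le> j \<Longrightarrow> j \<le> l \<Longrightarrow> (q i, q j) \<in> R \<longleftrightarrow> j = Suc i"
    using r.induced_end by blast
  have sq: "s \<noteq> q j" "(s, q j) \<notin> R" "(q j, s) \<notin> R" if "j \<le> l" for j
    using separated[OF k(1,3), of "q j"] that by auto
  have tp: "t \<noteq> p j" "(t, p j) \<notin> R" "(p j, t) \<notin> R" if "j \<le> m" for j
    using r.separated[OF k'(1,3), of "p j"] that by auto
  have "t \<in> insert d (q ` {..l})" using k' by auto
  note st = separated[OF k(1,3) this]
  define P Q where "P = p ` {k..m}" and "Q = q ` {k'..l}"
  define W where "W = {s, t} \<union> P \<union> Q"
  have P: "(\<lambda>i. p (i + k)) ` {..m - k} = P" and Q: "(\<lambda>i. q (i + k')) ` {..l - k'} = Q"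
    unfolding P_def Q_def by (rule image_shift_atMost; fact)+
  have "s \<notin> P" "s \<notin> Q" "t \<notin> P" "t \<notin> Q"
    using s(1) sq(1) t(1) tp(1) unfolding P_def Q_def by (metis imageE atLeastAtMost_iff)+
  have arcs: "R \<inter> W \<times> W = {(p k, s), (q k', t)} \<union>
      (\<lambda>i. (p i, p (Suc i))) ` {k..<m} \<union> (\<lambda>i. (q i, q (Suc i))) ` {k'..<l}" (is "_ = ?A")
  proof (rule subset_antisym)
    have pp: "(u, v) \<in> ?A" if uv: "(u, v) \<in> R" "u \<in> P" "v \<in> P" for u v
    proof -
      obtain i j where *: "u = p i" "v = p j" "i \<in> {k..m}" "j \<in> {k..m}" using uv P_def by auto
      then have "j = Suc i" using p[of i j] uv(1) by auto
      then show ?thesis using * by auto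
    qed
    have qq: "(u, v) \<in> ?A" if uv: "(u, v) \<in> R" "u \<in> Q" "v \<in> Q" for u v
    proof -
      obtain i j where *: "u = q i" "v = q j" "i \<in> {k'..l}" "j \<in> {k'..l}" using uv Q_def by auto
      then have "j = Suc i" using q[of i j] uv(1) by auto
      then show ?thesis using * by auto
    qed
    have mP: "p m \<in> P" and lQ: "q l \<in> Q" using k(1) k'(1) by (auto simp: P_def Q_def)
    \<comment> \<open>A cross arc must enter the meeting vertex, which lies on both tails, so it is
      already an arc inside \<open>P\<close>.\<close>
    have pq: "(u, v) \<in> ?A" if uv: "(u, v) \<in> R" "u \<in> P" "v \<in> Q" for u v
    proof -
      obtain i j where *: "u = p i" "v = q j" "i \<le> m" "j \<le> l" using uv P_def Q_def by auto
      then have "v = p m" using no_cross_arc[of i j] uv(1) meet by auto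
      then show ?thesis using pp uv mP by blast
    qed
    have qp: "(u, v) \<in> ?A" if uv: "(u, v) \<in> R" "u \<in> Q" "v \<in> P" for u v
    proof -
      obtain i j where *: "u = q i" "v = p j" "i \<le> l" "j \<le> m" using uv P_def Q_def by auto
      then have "v = q l" using r.no_cross_arc[of i j] uv(1) meet by auto
      then show ?thesis using qq uv lQ by blast
    qed
    have s_out: "(s, v) \<notin> R" if "v \<in> W" for v
      using that loopfree st s(2) sq(2) by (auto simp: W_def P_def Q_def)
    have t_out: "(t, v) \<notin> R" if "v \<in> W" for v
      using that loopfree st t(2) tp(2) by (auto simp: W_def P_def Q_def)
    have s_in: "(u, s) \<in> ?A" if uv: "(u, s) \<in> R" "u \<in> P" for u
    proof -
      obtain i where "u = p i" "k \<le> i" "i \<le> m" using uv(2) P_def by auto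
      then show ?thesis using s(3)[of i] uv(1) by (cases "i = k") auto
    qed
    have s_in': "(u, s) \<notin> R" if "u \<in> Q" for u using that sq(3) by (auto simp: Q_def)
    have t_in: "(u, t) \<in> ?A" if uv: "(u, t) \<in> R" "u \<in> Q" for u
    proof -
      obtain i where "u = q i" "k' \<le> i" "i \<le> l" using uv(2) Q_def by auto
      then show ?thesis using t(3)[of i] uv(1) by (cases "i = k'") auto
    qed
    have t_in': "(u, t) \<notin> R" if "u \<in> P" for u using that tp(3) by (auto simp: P_def)
    show "R \<inter> W \<times> W \<subseteq> ?A"
    proof
      fix e assume "e \<in> R \<inter> W \<times> W"
      then obtain u v where e: "e = (u, v)" and uv: "(u, v) \<in> R" "u \<in> W" "v \<in> W" by (cases e) auto
      define B where "B = ?A"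
      have "u \<in> P \<or> u \<in> Q" using uv s_out t_out by (auto simp: W_def)
      moreover have "v = s \<or> v = t \<or> v \<in> P \<or> v \<in> Q" using uv(3) by (auto simp: W_def)
      ultimately have "(u, v) \<in> B"
        using pp[folded B_def] qq[folded B_def] pq[folded B_def] qp[folded B_def]
          s_in[folded B_def] t_in[folded B_def] s_in' t_in' uv(1) by metis
      then show "e \<in> ?A" using e B_def by simp
    qed
    have "(p i, p (Suc i)) \<in> R \<inter> W \<times> W" if "i \<in> {k..<m}" for i
      using that p[of i "Suc i"] by (auto simp: W_def P_def)
    moreover have "(q i, q (Suc i)) \<in> R \<inter> W \<times> W" if "i \<in> {k'..<l}" for i
      using that q[of i "Suc i"] by (auto simp: W_def Q_def)
    moreover have "{(p k, s), (q k', t)} \<subseteq> R \<inter> W \<times> W"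
      using k k' by (auto simp: W_def P_def Q_def)
    ultimately show "?A \<subseteq> R \<inter> W \<times> W" by (auto simp only: image_subset_iff Un_subset_iff)
  qed
  show ?thesis
  proof (rule contains_A4_minusI[where p = "\<lambda>i. p (i + k)" and q = "\<lambda>i. q (i + k')" and s = s and t = t and W = W
        and m = "m - k" and l = "l - k'"])
    show "inj_on (\<lambda>i. p (i + k)) {..m - k}"
      using p_distinct by (intro linorder_inj_onI) (auto simp: less_diff_conv)
    show "inj_on (\<lambda>i. q (i + k')) {..l - k'}"
      using r.p_distinct by (intro linorder_inj_onI) (auto simp: less_diff_conv)
    show "i = m - k \<and> j = l - k'" if "i \<le> m - k" "j \<le> l - k'" "p (i + k) = q (j + k')" for i j
    proof -
      have "i + k \<le> m" "j + k' \<le> l" using that k(1) k'(1) by linarith+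
      then show ?thesis using cross_disjoint[of "i + k" "j + k'"] that(3) by linarith
    qed
    show "s \<notin> (\<lambda>i. p (i + k)) ` {..m - k} \<union> (\<lambda>i. q (i + k')) ` {..l - k'}"
      "t \<notin> (\<lambda>i. p (i + k)) ` {..m - k} \<union> (\<lambda>i. q (i + k')) ` {..l - k'}"
      unfolding P Q using \<open>s \<notin> P\<close> \<open>s \<notin> Q\<close> \<open>t \<notin> P\<close> \<open>t \<notin> Q\<close> by auto
    show "W = {s, t} \<union> (\<lambda>i. p (i + k)) ` {..m - k} \<union> (\<lambda>i. q (i + k')) ` {..l - k'}"
      unfolding P Q W_def ..
    show "parcs G \<inter> W \<times> W = {(p (0 + k), s), (q (0 + k'), t)} \<union>
        (\<lambda>i. (p (i + k), p (Suc i + k))) ` {..<m - k} \<union> (\<lambda>i. (q (i + k'), q (Suc i + k'))) ` {..<l - k'}"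
      using arcs image_shift_lessThan[OF k(1), of "\<lambda>i. (p i, p (Suc i))"] image_shift_lessThan[OF k'(1), of "\<lambda>i. (q i, q (Suc i))"]
      by (simp add: R)
  qed (use wf k k' st meet in auto)
qed

end

section \<open>The reachability criterion for oriented graphs\<close>

text \<open>Existence of \<open>x\<close> makes the set of total walk lengths nonempty; its least
  element, possibly attained at another meeting vertex, provides the two paths for the
  construction.\<close>

lemma contains_A4_minus_iff:
  assumes "oriented_graph G"
  shows "contains_induced_subdivision G A4_minus \<longleftrightarrow>
    (\<exists>a \<in> pverts G. \<exists>b \<in> pverts G. \<exists>c \<in> pverts G. \<exists>d \<in> pverts G. end_arcs (parcs G) a b c d \<and>
      (\<exists>x \<in> pverts G. (b, x) \<in> (inner_arcs (parcs G) a b c d)\<^sup>* \<and> (c, x) \<in> (inner_arcs (parcs G) a b c d)\<^sup>*))"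
    (is "_ \<longleftrightarrow> ?rhs")
proof
  assume "contains_induced_subdivision G A4_minus"
  then show ?rhs by (rule contains_A4_minusE) blast
next
  assume ?rhs
  then obtain a b c d x where ends: "end_arcs (parcs G) a b c d"
    and reach: "(b, x) \<in> (inner_arcs (parcs G) a b c d)\<^sup>*" "(c, x) \<in> (inner_arcs (parcs G) a b c d)\<^sup>*"
    by blast
  let ?E = "inner_arcs (parcs G) a b c d"
  let ?M = "\<lambda>n. \<exists>y i j. (b, y) \<in> ?E ^^ i \<and> (c, y) \<in> ?E ^^ j \<and> n = i + j"
  obtain i j where "(b, x) \<in> ?E ^^ i" "(c, x) \<in> ?E ^^ j" using reach rtrancl_imp_relpow by metis
  then have "\<exists>n. ?M n" by blast
  from LeastI_ex[OF this] obtain y m l where ml: "(b, y) \<in> ?E ^^ m" "(c, y) \<in> ?E ^^ l" "Least ?M = m + l"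
    by blast
  have min: "m + l \<le> i + j" if "(b, z) \<in> ?E ^^ i" "(c, z) \<in> ?E ^^ j" for z i j
    unfolding ml(3)[symmetric] by (rule Least_le) (use that in blast)
  obtain p where p: "p 0 = b" "p m = y" "\<And>i. i < m \<Longrightarrow> (p i, p (Suc i)) \<in> ?E"
    using ml(1) unfolding relpow_fun_conv by blast
  obtain q where q: "q 0 = c" "q l = y" "\<And>i. i < l \<Longrightarrow> (q i, q (Suc i)) \<in> ?E"
    using ml(2) unfolding relpow_fun_conv by blast
  interpret shortest_meeting "parcs G" a b c d p q m l
    by unfold_locales (use oriented_graphD(3)[OF assms] ends p q min in auto)
  show "contains_induced_subdivision G A4_minus"
    using contains_A4_minus oriented_graphD(1)[OF assms] by blast
qed

section \<open>The program and its running time\<close>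

text \<open>The time is bounded from above because exact counts depend on the branches taken,
  whereas bounds compose.\<close>

definition runs :: "com \<Rightarrow> state \<Rightarrow> nat \<Rightarrow> (state \<Rightarrow> bool) \<Rightarrow> bool" where
  "runs c s T Q \<longleftrightarrow> (\<exists>t s'. exec c s t s' \<and> t \<le> T \<and> Q s')"

abbreviation set_reg :: "nat \<Rightarrow> nat \<Rightarrow> state \<Rightarrow> state" where
  "set_reg x v s \<equiv> s\<lparr>regs := (regs s)(x := v)\<rparr>"

abbreviation set_cell :: "nat \<Rightarrow> nat \<Rightarrow> nat \<Rightarrow> state \<Rightarrow> state" where
  "set_cell a i v s \<equiv> s\<lparr>arrays := (arrays s)(a := (arrays s a)(i := v))\<rparr>"

lemma runs_mono: "runs c s T P \<Longrightarrow> T \<le> T' \<Longrightarrow> (\<And>s'. P s' \<Longrightarrow> Q s') \<Longrightarrow> runs c s T' Q"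
  unfolding runs_def using le_trans by blast

lemma runs_Skip: "Q s \<Longrightarrow> runs Skip s 1 Q"
  unfolding runs_def using exec.Skip by blast

lemma runs_SetReg: "Q (set_reg x (aval e s) s) \<Longrightarrow> runs (SetReg x e) s 1 Q"
  unfolding runs_def using exec.SetReg by blast

lemma runs_SetCell: "Q (set_cell a (aval i s) (aval e s) s) \<Longrightarrow> runs (SetCell a i e) s 1 Q"
  unfolding runs_def using exec.SetCell by blast

lemma runs_Seq: "runs c1 s T1 P \<Longrightarrow> (\<And>s'. P s' \<Longrightarrow> runs c2 s' T2 Q) \<Longrightarrow> runs (Seq c1 c2) s (T1 + T2) Q"
  unfolding runs_def using exec.Seq add_mono by metis

lemma runs_Cond:
  assumes "bval b s \<Longrightarrow> runs c1 s T Q" "\<not> bval b s \<Longrightarrow> runs c2 s T Q"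
  shows "runs (Cond b c1 c2) s (1 + T) Q"
proof (cases "bval b s")
  case True
  then obtain t s' where "exec c1 s t s'" "t \<le> T" "Q s'" using assms(1) unfolding runs_def by blast
  then show ?thesis using exec.CondTrue[of b s c1 t s' c2] True unfolding runs_def by (meson add_left_mono)
next
  case False
  then obtain t s' where "exec c2 s t s'" "t \<le> T" "Q s'" using assms(2) unfolding runs_def by blast
  then show ?thesis using exec.CondFalse[of b s c2 t s' c1] False unfolding runs_def by (meson add_left_mono)
qed

text \<open>\<open>I i\<close> describes the state after \<open>i\<close> rounds, and
  \<open>N\<close> bounds their number. Each round pays for its body and one test; the last summand
  is the test that fails.\<close>

lemma runs_While:
  assumes step: "\<And>i s. I i s \<Longrightarrow> bval b s \<Longrightarrow> i < N \<and> runs c s T (I (Suc i))"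
  shows "I i s \<Longrightarrow> runs (While b c) s ((N - i) * (T + 1) + 1) (\<lambda>s'. \<not> bval b s' \<and> (\<exists>j. I j s'))"
proof (induction "N - i" arbitrary: i s)
  case 0
  then have "\<not> bval b s" using step by fastforce
  then show ?case using 0 exec.WhileFalse[of b s c] unfolding runs_def by auto
next
  case (Suc k)
  show ?case
  proof (cases "bval b s")
    case False
    then show ?thesis using Suc exec.WhileFalse[of b s c] unfolding runs_def by force
  next
    case True
    obtain t1 s1 where 1: "exec c s t1 s1" "t1 \<le> T" "I (Suc i) s1"
      using step[OF Suc.prems True] unfolding runs_def by blast
    have "runs (While b c) s1 ((N - Suc i) * (T + 1) + 1) (\<lambda>s'. \<not> bval b s' \<and> (\<exists>j. I j s'))"
    proof (rule Suc.hyps(1))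
      show "k = N - Suc i" using Suc.hyps(2) by simp
    qed fact
    then obtain t2 s2 where 2: "exec (While b c) s1 t2 s2" "t2 \<le> (N - Suc i) * (T + 1) + 1"
        "\<not> bval b s2" "\<exists>j. I j s2"
      unfolding runs_def by blast
    have eq: "N - i = Suc (N - Suc i)" using Suc.hyps(2) by simp
    have "1 + t1 + t2 \<le> (N - i) * (T + 1) + 1" unfolding eq using 1(2) 2(2) by simp
    then show ?thesis
      using exec.WhileTrue[OF True 1(1) 2(1)] 2(3,4) unfolding runs_def by blast
  qed
qed

definition for_loop :: "nat \<Rightarrow> nat \<Rightarrow> com \<Rightarrow> com" where
  "for_loop x r c = Seq (SetReg x (Const 0))
     (While (Less (Reg x) (Reg r)) (Seq c (SetReg x (Plus (Reg x) (Const 1)))))"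

text \<open>Each round pays for body, increment and test; the two extra steps are the initialisation
  and the failing test. A bound \<open>B\<close> in place of the number of rounds makes times depend
  on the input length alone.\<close>

definition loop_time :: "nat \<Rightarrow> nat \<Rightarrow> nat" where
  "loop_time B T = B * (T + 2) + 2"

lemma runs_for_loop:
  assumes init: "I 0 (set_reg x 0 s)" and r: "regs s r = N" "x \<noteq> r" and B: "N \<le> B"
    and step: "\<And>i s. I i s \<Longrightarrow> regs s x = i \<Longrightarrow> regs s r = N \<Longrightarrow> i < N \<Longrightarrow>
      runs c s T (\<lambda>s'. regs s' x = i \<and> regs s' r = N \<and> I (Suc i) (set_reg x (Suc i) s'))"
    and post: "\<And>s'. I N s' \<Longrightarrow> regs s' r = N \<Longrightarrow> Q s'"
  shows "runs (for_loop x r c) s (loop_time B T) Q"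
proof -
  let ?J = "\<lambda>i s. I i s \<and> regs s x = i \<and> regs s r = N \<and> i \<le> N"
  let ?w = "While (Less (Reg x) (Reg r)) (Seq c (SetReg x (Plus (Reg x) (Const 1))))"
  have w: "runs ?w s' (N * (T + 2) + 1) Q" if "?J 0 s'" for s'
  proof (rule runs_mono[OF runs_While[where I = ?J and N = N and T = "T + 1"]])
    fix i s assume *: "?J i s" "bval (Less (Reg x) (Reg r)) s"
    then have i: "i < N" by simp
    moreover have "runs (Seq c (SetReg x (Plus (Reg x) (Const 1)))) s (T + 1) (?J (Suc i))"
    proof (rule runs_Seq)
      show "runs c s T (\<lambda>s'. regs s' x = i \<and> regs s' r = N \<and> I (Suc i) (set_reg x (Suc i) s'))"
        using step * i by blast
    qed (rule runs_SetReg; use i r(2) in auto)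
    ultimately show "i < N \<and> runs (Seq c (SetReg x (Plus (Reg x) (Const 1)))) s (T + 1) (?J (Suc i))" ..
  next
    fix s' assume "\<not> bval (Less (Reg x) (Reg r)) s' \<and> (\<exists>j. ?J j s')"
    then show "Q s'" using post by auto
  qed (use that in auto)
  have "runs (for_loop x r c) s (1 + (N * (T + 2) + 1)) Q"
    unfolding for_loop_def
    by (rule runs_Seq[where P = "?J 0"], rule runs_SetReg) (use init r w in auto)
  then show ?thesis
  proof (rule runs_mono)
    have "N * (T + 2) \<le> B * (T + 2)" using B by (rule mult_le_mono1)
    then show "1 + (N * (T + 2) + 1) \<le> loop_time B T" by (simp add: loop_time_def)
  qed
qed

section \<open>Nested search loops\<close>

text \<open>Nested search loops keep their loop variables in the registers from 3 on and collect the
  result in register 2.\<close>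

definition search_state :: "(state \<Rightarrow> bool) \<Rightarrow> nat list \<Rightarrow> bool \<Rightarrow> state \<Rightarrow> bool" where
  "search_state J xs found s \<longleftrightarrow>
     J s \<and> (\<forall>i<length xs. regs s (3 + i) = xs ! i) \<and> regs s 2 = of_bool found"

text \<open>The flag is only ever raised, hence the disjunction with earlier findings;
  \<open>xs\<close> holds the values of the enclosing loop variables.\<close>

definition searches :: "(state \<Rightarrow> bool) \<Rightarrow> nat \<Rightarrow> nat \<Rightarrow> com \<Rightarrow> (nat list \<Rightarrow> bool) \<Rightarrow> nat \<Rightarrow> bool" where
  "searches J n k c P T \<longleftrightarrow> (\<forall>xs found s. length xs = k \<longrightarrow> set xs \<subseteq> {..<n} \<longrightarrow>
     search_state J xs found s \<longrightarrow> runs c s T (search_state J xs (found \<or> P xs)))"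

lemma searches_test:
  assumes J: "\<And>s v. J s \<Longrightarrow> J (set_reg 2 v s)"
    and b: "\<And>xs s. length xs = k \<Longrightarrow> set xs \<subseteq> {..<n} \<Longrightarrow> J s \<Longrightarrow>
      (\<And>i. i < k \<Longrightarrow> regs s (3 + i) = xs ! i) \<Longrightarrow> bval b s \<longleftrightarrow> P xs"
  shows "searches J n k (Cond b (SetReg 2 (Const 1)) Skip) P 2"
  unfolding searches_def
proof (intro allI impI)
  fix xs found s
  assume xs: "length xs = k" "set xs \<subseteq> {..<n}" and s: "search_state J xs found s"
  then have bP: "bval b s \<longleftrightarrow> P xs" by (intro b) (auto simp: search_state_def)
  have "runs (Cond b (SetReg 2 (Const 1)) Skip) s (1 + 1) (search_state J xs (found \<or> P xs))"
  proof (rule runs_Cond)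
    assume "bval b s"
    then show "runs (SetReg 2 (Const 1)) s 1 (search_state J xs (found \<or> P xs))"
      using s J bP by (intro runs_SetReg) (auto simp: search_state_def)
  next
    assume "\<not> bval b s"
    then show "runs Skip s 1 (search_state J xs (found \<or> P xs))"
      using s bP by (intro runs_Skip) simp
  qed
  then show "runs (Cond b (SetReg 2 (Const 1)) Skip) s 2 (search_state J xs (found \<or> P xs))"
    by (simp add: numeral_2_eq_2)
qed

text \<open>Entering the loop appends its counter to \<open>xs\<close>, and the disjunction
  collected over all counter values is the existential quantifier. Nesting thus yields searches over
  tuples.\<close>

lemma searches_loop:
  assumes c: "searches J n (Suc k) c P T" and n: "\<And>s. J s \<Longrightarrow> regs s 1 = n" "n \<le> B"
    and J: "\<And>s x v. 2 \<le> x \<Longrightarrow> J s \<Longrightarrow> J (set_reg x v s)"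
  shows "searches J n k (for_loop (3 + k) 1 c) (\<lambda>xs. \<exists>x<n. P (xs @ [x])) (loop_time B T)"
  unfolding searches_def
proof (intro allI impI)
  fix xs found s
  assume xs: "length xs = k" "set xs \<subseteq> {..<n}" and s: "search_state J xs found s"
  let ?I = "\<lambda>i. search_state J xs (found \<or> (\<exists>x<i. P (xs @ [x])))"
  have set_k: "search_state J xs f (set_reg (3 + k) v s')" if "search_state J xs f s'" for f v s'
    using that J xs(1) by (auto simp: search_state_def)
  show "runs (for_loop (3 + k) 1 c) s (loop_time B T) (search_state J xs (found \<or> (\<exists>x<n. P (xs @ [x]))))"
  proof (rule runs_for_loop[where I = ?I and N = n])
    show "?I 0 (set_reg (3 + k) 0 s)" using set_k s by simp
    show "regs s 1 = n" using s n by (simp add: search_state_def)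
    fix i s' assume I: "?I i s'" and i: "regs s' (3 + k) = i" "i < n"
    have "search_state J (xs @ [i]) (found \<or> (\<exists>x<i. P (xs @ [x]))) s'"
      using I i xs(1) by (auto simp: search_state_def nth_append less_Suc_eq)
    then have "runs c s' T (search_state J (xs @ [i]) ((found \<or> (\<exists>x<i. P (xs @ [x]))) \<or> P (xs @ [i])))"
      using c[unfolded searches_def, rule_format, of "xs @ [i]"] xs i(2) by (simp del: disj_assoc)
    then show "runs c s' T (\<lambda>s''. regs s'' (3 + k) = i \<and> regs s'' 1 = n \<and> ?I (Suc i) (set_reg (3 + k) (Suc i) s''))"
    proof (rule runs_mono)
      fix s'' assume *: "search_state J (xs @ [i]) ((found \<or> (\<exists>x<i. P (xs @ [x]))) \<or> P (xs @ [i])) s''"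
      have "((found \<or> (\<exists>x<i. P (xs @ [x]))) \<or> P (xs @ [i])) \<longleftrightarrow> (found \<or> (\<exists>x<Suc i. P (xs @ [x])))"
        by (auto simp: less_Suc_eq)
      with * have st: "search_state J (xs @ [i]) (found \<or> (\<exists>x<Suc i. P (xs @ [x]))) s''" by simp
      have "regs s'' (3 + j) = (xs @ [i]) ! j" if "j < Suc k" for j
        using st that xs(1) by (simp add: search_state_def)
      note nth = this
      have "regs s'' (3 + k) = i" "\<forall>j<k. regs s'' (3 + j) = xs ! j"
        using nth[of k] nth xs(1) by (auto simp: nth_append less_Suc_eq)
      then show "regs s'' (3 + k) = i \<and> regs s'' 1 = n \<and> ?I (Suc i) (set_reg (3 + k) (Suc i) s'')"
        using st n(1) xs(1) J[of "3 + k"] by (simp add: search_state_def)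
    qed simp
  qed (use n in auto)
qed

section \<open>Tests on the adjacency matrix\<close>

definition code_arcs :: "bool list \<Rightarrow> nat \<Rightarrow> nat rel" where
  "code_arcs w n = {(u, v). u < n \<and> v < n \<and> w ! (u * n + v)}"

text \<open>The machine cannot multiply, so array 1 is a table of the row offsets.\<close>

definition input_state :: "bool list \<Rightarrow> nat \<Rightarrow> state \<Rightarrow> bool" where
  "input_state w n s \<longleftrightarrow> regs s 0 = length w \<and> regs s 1 = n \<and>
     (\<forall>i<length w. arrays s 0 i = of_bool (w ! i)) \<and> (\<forall>u<n. arrays s 1 u = u * n)"

definition is_arc :: "nat \<Rightarrow> nat \<Rightarrow> bexp" where
  "is_arc x y = Equal (Cell 0 (Plus (Cell 1 (Reg x)) (Reg y))) (Const 1)"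

abbreviation no_arc :: "nat \<Rightarrow> nat \<Rightarrow> bexp" where
  "no_arc x y \<equiv> Neg (is_arc x y)"

lemma bval_is_arc:
  assumes "input_state w n s" "n * n = length w" "regs s x < n" "regs s y < n"
  shows "bval (is_arc x y) s \<longleftrightarrow> (regs s x, regs s y) \<in> code_arcs w n"
proof -
  have "regs s x * n + regs s y < Suc (regs s x) * n" using assms(4) by simp
  also have "\<dots> \<le> n * n" using assms(3) by (intro mult_le_mono1) simp
  finally have "regs s x * n + regs s y < length w" using assms(2) by simp
  then show ?thesis using assms by (auto simp: is_arc_def input_state_def code_arcs_def)
qed

text \<open>Registers 3 to 6 hold \<open>a, b, c, d\<close>; register 9 holds the vertex that is tested.\<close>

definition is_end_arcs :: bexp where
  "is_end_arcs = Conj (is_arc 4 3) (Conj (is_arc 5 6) (Conj (no_arc 4 5) (Conj (no_arc 5 4)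
     (Conj (no_arc 3 5) (Conj (no_arc 5 3) (Conj (no_arc 3 6) (Conj (no_arc 6 3)
     (Conj (no_arc 4 6) (no_arc 6 4)))))))))"

definition is_inner_vertex :: bexp where
  "is_inner_vertex = Conj (Neg (Equal (Reg 9) (Reg 3))) (Conj (Neg (Equal (Reg 9) (Reg 6)))
     (Conj (no_arc 9 3) (Conj (no_arc 3 9) (Conj (no_arc 9 6) (Conj (no_arc 6 9)
     (Conj (no_arc 9 4) (no_arc 9 5)))))))"

section \<open>Computing reachability\<close>

definition mark_step :: "nat \<Rightarrow> com" where
  "mark_step A = Cond (Conj (Equal (Cell A (Reg 8)) (Const 1)) (Conj (is_arc 8 9) is_inner_vertex))
     (SetCell A (Reg 9) (Const 1)) Skip"

text \<open>Rounds of relaxation over all pairs, as in the method of Bellman and Ford. The outer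
  loop runs up to register 0, the word length \<open>n * n\<close>, which bounds the number of arcs
  and hence the walk lengths to be considered.\<close>

definition mark_reachable :: "nat \<Rightarrow> nat \<Rightarrow> com" where
  "mark_reachable A z = Seq (for_loop 7 1 (SetCell A (Reg 7) (Const 0)))
     (Seq (SetCell A (Reg z) (Const 1)) (for_loop 7 0 (for_loop 8 1 (for_loop 9 1 (mark_step A)))))"

definition mark_time :: "nat \<Rightarrow> nat" where
  "mark_time B = loop_time B 1 + (1 + loop_time B (loop_time B (loop_time B 2)))"

lemma finite_code_arcs: "finite (code_arcs w n)"
  by (rule finite_subset[of _ "{..<n} \<times> {..<n}"]) (auto simp: code_arcs_def)

lemma card_code_arcs: "card (code_arcs w n) \<le> n * n"
proof -
  have "card (code_arcs w n) \<le> card ({..<n} \<times> {..<n})"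
    by (rule card_mono) (auto simp: code_arcs_def)
  then show ?thesis by simp
qed

text \<open>Marks are sandwiched: after \<open>k\<close> rounds all vertices within \<open>k\<close>
  steps are marked, and only reachable ones ever are. An exact description by \<open>k\<close> would
  fail, since a round may pass on marks set earlier in the same round.\<close>

lemma runs_mark_reachable:
  assumes s0: "input_state w n s0" and w: "n * n = length w" and n: "n \<le> B" "n * n \<le> B"
    and R: "regs s0 3 < n" "regs s0 4 < n" "regs s0 5 < n" "regs s0 6 < n"
    and z: "z = 4 \<or> z = 5" and A: "2 \<le> A"
    and E: "E = inner_arcs (code_arcs w n) (regs s0 3) (regs s0 4) (regs s0 5) (regs s0 6)"
  shows "runs (mark_reachable A z) s0 (mark_time B) (\<lambda>s.
     (\<forall>x<7. regs s x = regs s0 x) \<and> (\<forall>a. a \<noteq> A \<longrightarrow> arrays s a = arrays s0 a) \<and>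
     (\<forall>x<n. arrays s A x = of_bool ((regs s0 z, x) \<in> E\<^sup>*)))"
proof -
  define same where "same s \<longleftrightarrow> (\<forall>x<7. regs s x = regs s0 x) \<and> (\<forall>a. a \<noteq> A \<longrightarrow> arrays s a = arrays s0 a)" for s :: state
  have same_reg: "same (set_reg x v s) \<longleftrightarrow> same s" if "7 \<le> x" for x v s
    using that by (auto simp: same_def)
  have same_cell: "same (set_cell A i v s) \<longleftrightarrow> same s" for i v s
    by (auto simp: same_def)
  have same_regs: "regs s 0 = length w" "regs s 1 = n" "regs s z = regs s0 z" "regs s 3 = regs s0 3"
    "regs s 4 = regs s0 4" "regs s 5 = regs s0 5" "regs s 6 = regs s0 6" if "same s" for s
    using that s0 z by (auto simp: same_def input_state_def)
  have same_input: "input_state w n s" if "same s" for s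
    using that s0 A by (auto simp: same_def input_state_def)
  have Elt: "u < n" "v < n" if "(u, v) \<in> E" for u v
    using that by (auto simp: E inner_arcs_def code_arcs_def)
  have zn: "regs s0 z < n" using z R by auto
  have step_iff: "bval (Conj (Equal (Cell A (Reg 8)) (Const 1)) (Conj (is_arc 8 9) is_inner_vertex)) s \<longleftrightarrow>
      arrays s A u = 1 \<and> (u, v) \<in> E"
    if s: "same s" and uv: "regs s 8 = u" "regs s 9 = v" "u < n" "v < n" for s u v
  proof -
    have lt: "regs s 3 < n" "regs s 4 < n" "regs s 5 < n" "regs s 6 < n" "regs s 8 < n" "regs s 9 < n"
      using same_regs[OF s] R uv by simp_all
    note arc = bval_is_arc[OF same_input[OF s] w]
    show ?thesis
      using uv(1,2) unfolding is_inner_vertex_def E inner_arcs_def inner_vertex_def bval.simps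
        arc[OF lt(5,6)] arc[OF lt(6,1)] arc[OF lt(1,6)] arc[OF lt(6,4)] arc[OF lt(4,6)] arc[OF lt(6,2)] arc[OF lt(6,3)]
      by (auto simp: same_regs[OF s])
  qed
  define near where "near k = {x. \<exists>j\<le>k. (regs s0 z, x) \<in> E ^^ j}" for k
  \<comment> \<open>The bound by 1 turns "not marked" into the value 0 at the end.\<close>
  define ok where "ok k s \<longleftrightarrow> same s \<and> (\<forall>x<n. arrays s A x \<le> 1) \<and>
    (\<forall>x<n. arrays s A x = 1 \<longrightarrow> (regs s0 z, x) \<in> E\<^sup>*) \<and> (\<forall>x\<in>near k. arrays s A x = 1)" for k and s :: state
  have ok_reg: "ok k (set_reg x v s) \<longleftrightarrow> ok k s" if "7 \<le> x" for k x v s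
    using that same_reg by (simp add: ok_def)
  have ok_same: "same s" if "ok k s" for k s using that by (simp add: ok_def)
  have near_Suc: "x \<in> near k \<or> (\<exists>u \<in> near k. (u, x) \<in> E)" if x: "x \<in> near (Suc k)" for x k
  proof -
    obtain j where j: "j \<le> Suc k" "(regs s0 z, x) \<in> E ^^ j" using x by (auto simp: near_def)
    show ?thesis
    proof (cases j)
      case 0
      then show ?thesis using j(2) by (auto simp: near_def intro: exI[of _ 0])
    next
      case (Suc i)
      then obtain u where "(regs s0 z, u) \<in> E ^^ i" "(u, x) \<in> E" using j(2) by auto
      then show ?thesis using Suc j(1) by (auto simp: near_def)
    qed
  qed
  \<comment> \<open>Restricted to \<open>u\<close> in \<open>near k\<close>, whose mark is present
    during the whole round; since marks are never removed, a pair once done stays done.\<close>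
  define done_at where "done_at k u v s \<longleftrightarrow> (u \<in> near k \<longrightarrow> (u, v) \<in> E \<longrightarrow> arrays s A v = 1)" for k u v and s :: state
  have done_reg: "done_at k u v (set_reg x y s) \<longleftrightarrow> done_at k u v s" for k u v x y s
    by (simp add: done_at_def)
  have mark: "runs (mark_step A) s (1 + 1) (\<lambda>s'. ok k s' \<and> (\<forall>x. regs s' x = regs s x) \<and> done_at k u v s' \<and>
      (\<forall>u v. done_at k u v s \<longrightarrow> done_at k u v s'))"
    if s: "ok k s" and uv: "regs s 8 = u" "regs s 9 = v" "u < n" "v < n" for k u v s
    unfolding mark_step_def
  proof (rule runs_Cond)
    note iff = step_iff[OF ok_same[OF s] uv]
    assume "bval (Conj (Equal (Cell A (Reg 8)) (Const 1)) (Conj (is_arc 8 9) is_inner_vertex)) s"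
    then have *: "arrays s A u = 1" "(u, v) \<in> E" unfolding iff by auto
    then have "(regs s0 z, v) \<in> E\<^sup>*" using s uv by (auto simp: ok_def intro: rtrancl_into_rtrancl)
    then show "runs (SetCell A (Reg 9) (Const 1)) s 1 (\<lambda>s'. ok k s' \<and> (\<forall>x. regs s' x = regs s x) \<and>
        done_at k u v s' \<and> (\<forall>u v. done_at k u v s \<longrightarrow> done_at k u v s'))"
      using s uv by (intro runs_SetCell) (auto simp: ok_def same_cell done_at_def)
  next
    note iff = step_iff[OF ok_same[OF s] uv]
    assume "\<not> bval (Conj (Equal (Cell A (Reg 8)) (Const 1)) (Conj (is_arc 8 9) is_inner_vertex)) s"
    then have "done_at k u v s" unfolding iff using s by (auto simp: done_at_def ok_def)
    then show "runs Skip s 1 (\<lambda>s'. ok k s' \<and> (\<forall>x. regs s' x = regs s x) \<and>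
        done_at k u v s' \<and> (\<forall>u v. done_at k u v s \<longrightarrow> done_at k u v s'))"
      using s by (intro runs_Skip) auto
  qed
  have v_loop: "runs (for_loop 9 1 (mark_step A)) s (loop_time B 2) (\<lambda>s'. ok k s' \<and> regs s' 7 = regs s 7 \<and>
      regs s' 8 = u \<and> (\<forall>v<n. done_at k u v s') \<and> (\<forall>u v. done_at k u v s \<longrightarrow> done_at k u v s'))"
    if s: "ok k s" "regs s 8 = u" "u < n" for k u s
  proof (rule runs_for_loop[where N = n and I = "\<lambda>i s'. ok k s' \<and> regs s' 7 = regs s 7 \<and> regs s' 8 = u \<and>
        (\<forall>v<i. done_at k u v s') \<and> (\<forall>u v. done_at k u v s \<longrightarrow> done_at k u v s')"])
    show "regs s 1 = n" using same_regs ok_same s by blast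
    fix i s'
    assume *: "ok k s' \<and> regs s' 7 = regs s 7 \<and> regs s' 8 = u \<and>
        (\<forall>v<i. done_at k u v s') \<and> (\<forall>u v. done_at k u v s \<longrightarrow> done_at k u v s')"
      and i: "regs s' 9 = i" "regs s' 1 = n" "i < n"
    then have "runs (mark_step A) s' (1 + 1) (\<lambda>s''. ok k s'' \<and> (\<forall>x. regs s'' x = regs s' x) \<and> done_at k u i s'' \<and>
        (\<forall>u v. done_at k u v s' \<longrightarrow> done_at k u v s''))"
      using mark[of k s' u i] s by auto
    then show "runs (mark_step A) s' 2 (\<lambda>s''. regs s'' 9 = i \<and> regs s'' 1 = n \<and>
        ok k (set_reg 9 (Suc i) s'') \<and> regs (set_reg 9 (Suc i) s'') 7 = regs s 7 \<and>
        regs (set_reg 9 (Suc i) s'') 8 = u \<and> (\<forall>v<Suc i. done_at k u v (set_reg 9 (Suc i) s'')) \<and>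
        (\<forall>u v. done_at k u v s \<longrightarrow> done_at k u v (set_reg 9 (Suc i) s'')))"
      by (rule runs_mono) (use * i in \<open>auto simp: ok_reg done_reg less_Suc_eq\<close>)
  qed (use s n in \<open>auto simp: ok_reg done_reg\<close>)
  have u_loop: "runs (for_loop 8 1 (for_loop 9 1 (mark_step A))) s (loop_time B (loop_time B 2))
      (\<lambda>s'. ok k s' \<and> regs s' 7 = regs s 7 \<and> (\<forall>u<n. \<forall>v<n. done_at k u v s'))"
    if s: "ok k s" for k s
  proof (rule runs_for_loop[where N = n and I = "\<lambda>i s'. ok k s' \<and> regs s' 7 = regs s 7 \<and>
        (\<forall>u<i. \<forall>v<n. done_at k u v s')"])
    show "regs s 1 = n" using same_regs ok_same s by blast
    fix i s'
    assume *: "ok k s' \<and> regs s' 7 = regs s 7 \<and> (\<forall>u<i. \<forall>v<n. done_at k u v s')"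
      and i: "regs s' 8 = i" "regs s' 1 = n" "i < n"
    show "runs (for_loop 9 1 (mark_step A)) s' (loop_time B 2) (\<lambda>s''. regs s'' 8 = i \<and> regs s'' 1 = n \<and>
        ok k (set_reg 8 (Suc i) s'') \<and> regs (set_reg 8 (Suc i) s'') 7 = regs s 7 \<and>
        (\<forall>u<Suc i. \<forall>v<n. done_at k u v (set_reg 8 (Suc i) s'')))"
      by (rule runs_mono[OF v_loop[of k s' i]])
        (use * i same_regs(2) ok_same in \<open>auto simp: ok_reg done_reg less_Suc_eq\<close>)
  qed (use s n in \<open>auto simp: ok_reg\<close>)
  have Suc_ok: "ok (Suc k) s" if "ok k s" "\<forall>u<n. \<forall>v<n. done_at k u v s" for k s
  proof -
    have "arrays s A x = 1" if x: "x \<in> near (Suc k)" for x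
      using near_Suc[OF x]
    proof
      assume "x \<in> near k"
      then show ?thesis using \<open>ok k s\<close> by (simp add: ok_def)
    next
      assume "\<exists>u \<in> near k. (u, x) \<in> E"
      then obtain u where u: "u \<in> near k" "(u, x) \<in> E" by blast
      then have "done_at k u x s" using \<open>\<forall>u<n. \<forall>v<n. done_at k u v s\<close> Elt by blast
      then show ?thesis using u by (simp add: done_at_def)
    qed
    then show ?thesis using \<open>ok k s\<close> by (simp add: ok_def)
  qed
  have rounds: "runs (for_loop 7 0 (for_loop 8 1 (for_loop 9 1 (mark_step A)))) s
      (loop_time B (loop_time B (loop_time B 2))) (ok (n * n))"
    if s: "ok 0 s" for s
  proof (rule runs_for_loop[where N = "n * n" and I = ok])
    show "regs s 0 = n * n" using same_regs ok_same s w by metis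
    fix i s' assume *: "ok i s'" and i: "regs s' 7 = i" "regs s' 0 = n * n"
    show "runs (for_loop 8 1 (for_loop 9 1 (mark_step A))) s' (loop_time B (loop_time B 2))
        (\<lambda>s''. regs s'' 7 = i \<and> regs s'' 0 = n * n \<and> ok (Suc i) (set_reg 7 (Suc i) s''))"
    proof (rule runs_mono[OF u_loop[OF *]])
      fix s'' assume "ok i s'' \<and> regs s'' 7 = regs s' 7 \<and> (\<forall>u<n. \<forall>v<n. done_at i u v s'')"
      then show "regs s'' 7 = i \<and> regs s'' 0 = n * n \<and> ok (Suc i) (set_reg 7 (Suc i) s'')"
        using Suc_ok[of i s''] i same_regs(1)[OF ok_same] w by (simp add: ok_reg)
    qed simp
  qed (use s n in \<open>auto simp: ok_reg\<close>)
  have init: "runs (for_loop 7 1 (SetCell A (Reg 7) (Const 0))) s0 (loop_time B 1)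
      (\<lambda>s. same s \<and> (\<forall>x<n. arrays s A x = 0))"
  proof (rule runs_for_loop[where N = n and I = "\<lambda>i s. same s \<and> (\<forall>x<i. arrays s A x = 0)"])
    show "regs s0 1 = n" using s0 by (simp add: input_state_def)
    show "same (set_reg 7 0 s0) \<and> (\<forall>x<0. arrays (set_reg 7 0 s0) A x = 0)"
      by (simp add: same_reg) (simp add: same_def)
    fix i s
    assume "same s \<and> (\<forall>x<i. arrays s A x = 0)" "regs s 7 = i" "regs s 1 = n"
    then show "runs (SetCell A (Reg 7) (Const 0)) s 1 (\<lambda>s'. regs s' 7 = i \<and> regs s' 1 = n \<and>
        same (set_reg 7 (Suc i) s') \<and> (\<forall>x<Suc i. arrays (set_reg 7 (Suc i) s') A x = 0))"
      by (intro runs_SetCell) (auto simp: same_def less_Suc_eq)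
  qed (use n in auto)
  have start: "runs (SetCell A (Reg z) (Const 1)) s 1 (ok 0)"
    if s: "same s" "\<forall>x<n. arrays s A x = 0" for s
    using s zn by (intro runs_SetCell) (auto simp: ok_def same_cell same_regs near_def)
  have final: "arrays s A x = of_bool ((regs s0 z, x) \<in> E\<^sup>*)" if s: "ok (n * n) s" and x: "x < n" for s x
  proof (cases "(regs s0 z, x) \<in> E\<^sup>*")
    case True
    have sub: "E \<subseteq> code_arcs w n" by (auto simp: E inner_arcs_def)
    then have fin: "finite E" using finite_code_arcs finite_subset by blast
    have "card E \<le> n * n" using card_mono[OF finite_code_arcs sub] card_code_arcs le_trans by blast
    moreover obtain j where j: "j \<le> card E" "(regs s0 z, x) \<in> E ^^ j"
      using True unfolding rtrancl_finite_eq_relpow[OF fin] by auto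
    ultimately have "j \<le> n * n" by linarith
    then have "x \<in> near (n * n)" using j(2) by (auto simp: near_def)
    then show ?thesis using s True by (simp add: ok_def)
  next
    case False
    then have "arrays s A x \<noteq> 1" "arrays s A x \<le> 1" using s x by (auto simp: ok_def)
    then show ?thesis using False by simp
  qed
  show ?thesis
    unfolding mark_reachable_def mark_time_def
  proof (rule runs_Seq[OF init], rule runs_Seq)
    fix s assume "same s \<and> (\<forall>x<n. arrays s A x = 0)"
    then show "runs (SetCell A (Reg z) (Const 1)) s 1 (ok 0)" using start by simp
  next
    fix s assume "ok 0 s"
    from rounds[OF this] show "runs (for_loop 7 0 (for_loop 8 1 (for_loop 9 1 (mark_step A)))) s
        (loop_time B (loop_time B (loop_time B 2))) (\<lambda>s. (\<forall>x<7. regs s x = regs s0 x) \<and>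
        (\<forall>a. a \<noteq> A \<longrightarrow> arrays s a = arrays s0 a) \<and> (\<forall>x<n. arrays s A x = of_bool ((regs s0 z, x) \<in> E\<^sup>*)))"
      by (rule runs_mono) (use final ok_same in \<open>auto simp: same_def\<close>)
  qed
qed

section \<open>Searching for quadruples and for two-cycles\<close>

definition find_meeting :: com where
  "find_meeting = Cond is_end_arcs
     (Seq (mark_reachable 2 4) (Seq (mark_reachable 3 5)
       (for_loop 7 1 (Cond (Conj (Equal (Cell 2 (Reg 7)) (Const 1)) (Equal (Cell 3 (Reg 7)) (Const 1)))
         (SetReg 2 (Const 1)) Skip)))) Skip"

definition meeting_time :: "nat \<Rightarrow> nat" where
  "meeting_time B = 1 + (mark_time B + (mark_time B + loop_time B 2))"

definition common_reach :: "'a rel \<Rightarrow> 'a \<Rightarrow> 'a \<Rightarrow> 'a \<Rightarrow> 'a \<Rightarrow> 'a \<Rightarrow> bool" where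
  "common_reach R a b c d x \<longleftrightarrow> (b, x) \<in> (inner_arcs R a b c d)\<^sup>* \<and> (c, x) \<in> (inner_arcs R a b c d)\<^sup>*"

definition meeting :: "nat rel \<Rightarrow> nat \<Rightarrow> nat list \<Rightarrow> bool" where
  "meeting R n xs \<longleftrightarrow> end_arcs R (xs ! 0) (xs ! 1) (xs ! 2) (xs ! 3) \<and>
     (\<exists>x<n. common_reach R (xs ! 0) (xs ! 1) (xs ! 2) (xs ! 3) x)"

lemma input_state_set_reg: "2 \<le> x \<Longrightarrow> input_state w n s \<Longrightarrow> input_state w n (set_reg x v s)"
  by (auto simp: input_state_def)

lemma searches_find_meeting:
  assumes w: "n * n = length w" and B: "n \<le> B" "n * n \<le> B"
  shows "searches (input_state w n) n 4 find_meeting (meeting (code_arcs w n) n) (meeting_time B)"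
  unfolding searches_def
proof (intro allI impI)
  fix xs found s
  assume xs: "length xs = 4" "set xs \<subseteq> {..<n}" and s: "search_state (input_state w n) xs found s"
  define a b c d where "a = xs ! 0" and "b = xs ! 1" and "c = xs ! 2" and "d = xs ! 3"
  let ?R = "code_arcs w n"
  let ?Q = "search_state (input_state w n) xs (found \<or> meeting ?R n xs)"
  have regs: "regs s' 3 = a" "regs s' 4 = b" "regs s' 5 = c" "regs s' 6 = d" "regs s' 2 = of_bool f"
    if "search_state J xs f s'" for J f s'
  proof -
    have *: "regs s' (3 + i) = xs ! i" if "i < 4" for i
      using \<open>search_state J xs f s'\<close> xs(1) that by (simp add: search_state_def)
    show "regs s' 3 = a" "regs s' 4 = b" "regs s' 5 = c" "regs s' 6 = d"
      using *[of 0] *[of 1] *[of 2] *[of 3] by (simp_all add: a_def b_def c_def d_def)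
    show "regs s' 2 = of_bool f" using that by (simp add: search_state_def)
  qed
  have lt: "a < n" "b < n" "c < n" "d < n"
    using xs nth_mem[of _ xs] unfolding a_def b_def c_def d_def by (force)+
  have regs_lt: "regs s 3 < n" "regs s 4 < n" "regs s 5 < n" "regs s 6 < n"
    using regs[OF s] lt by simp_all
  have inp: "input_state w n s" using s by (simp add: search_state_def)
  have test: "bval is_end_arcs s \<longleftrightarrow> end_arcs ?R a b c d"
    using bval_is_arc[OF inp w] regs_lt regs[OF s] by (simp add: is_end_arcs_def end_arcs_def)
  let ?E = "inner_arcs ?R a b c d"
  let ?marked = "\<lambda>A z s'. \<forall>x<n. arrays s' A x = of_bool ((z, x) \<in> ?E\<^sup>*)"
  have keep: "search_state (input_state w n) xs found s'"
    if "\<forall>x<7. regs s' x = regs s x" "\<forall>A<2. arrays s' A = arrays s A" for s'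
    using that s xs(1) by (simp add: search_state_def input_state_def)
  show "runs find_meeting s (meeting_time B) ?Q"
    unfolding find_meeting_def meeting_time_def
  proof (rule runs_Cond)
    assume "bval is_end_arcs s"
    then have ends: "end_arcs ?R a b c d" using test by simp
    \<comment> \<open>With both mark tables in the invariant, the scan for a common vertex is one
      more level of nested search: register 7 is the fifth loop variable, after the four in
      \<open>xs\<close>.\<close>
    define J where "J s' \<longleftrightarrow> input_state w n s' \<and> ?marked 2 b s' \<and> ?marked 3 c s'" for s'
    have J_set_reg: "J (set_reg x v s')" if "2 \<le> x" "J s'" for x v s'
      using that input_state_set_reg by (simp add: J_def)
    have J_1: "regs s' 1 = n" if "J s'" for s'
      using that by (simp add: J_def input_state_def)
    let ?test = "Cond (Conj (Equal (Cell 2 (Reg 7)) (Const 1)) (Equal (Cell 3 (Reg 7)) (Const 1)))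
      (SetReg 2 (Const 1)) Skip"
    have "searches J n 5 ?test (\<lambda>ys. common_reach ?R a b c d (ys ! 4)) 2"
    proof (rule searches_test)
      fix ys s'
      assume ys: "length ys = 5" "set ys \<subseteq> {..<n}" "J s'" "\<And>i. i < 5 \<Longrightarrow> regs s' (3 + i) = ys ! i"
      have "regs s' 7 = ys ! 4" using ys(4)[of 4] by simp
      moreover have "ys ! 4 \<in> set ys" using ys(1) by simp
      then have "ys ! 4 < n" using ys(2) by auto
      ultimately show "bval (Conj (Equal (Cell 2 (Reg 7)) (Const 1)) (Equal (Cell 3 (Reg 7)) (Const 1))) s' \<longleftrightarrow>
          common_reach ?R a b c d (ys ! 4)"
        using ys(3) by (simp add: J_def common_reach_def)
    qed (rule J_set_reg; simp)
    then have "searches J n (Suc 4) ?test (\<lambda>ys. common_reach ?R a b c d (ys ! 4)) 2" by simp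
    note loop = searches_loop[OF this J_1 B(1) J_set_reg]
    have final: "runs (for_loop 7 1 ?test) s' (loop_time B 2) ?Q" if "search_state J xs found s'" for s'
    proof -
      have "runs (for_loop (3 + 4) 1 ?test) s' (loop_time B 2)
          (search_state J xs (found \<or> (\<exists>x<n. common_reach ?R a b c d ((xs @ [x]) ! 4))))"
        using loop that xs unfolding searches_def by blast
      moreover have "(3 :: nat) + 4 = 7" by simp
      moreover have "(\<exists>x<n. common_reach ?R a b c d ((xs @ [x]) ! 4)) \<longleftrightarrow> meeting ?R n xs"
        using ends xs(1) by (simp add: meeting_def a_def b_def c_def d_def nth_append)
      ultimately have "runs (for_loop 7 1 ?test) s' (loop_time B 2) (search_state J xs (found \<or> meeting ?R n xs))"
        by (simp only:)
      then show ?thesis by (rule runs_mono) (simp_all add: search_state_def J_def)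
    qed
    have *: "runs (mark_reachable 2 4) s (mark_time B) (\<lambda>s'.
       (\<forall>x<7. regs s' x = regs s x) \<and> (\<forall>a. a \<noteq> 2 \<longrightarrow> arrays s' a = arrays s a) \<and> ?marked 2 b s')"
      by (rule runs_mono[OF runs_mark_reachable[OF inp w B regs_lt _ _ refl]]) (simp_all add: regs[OF s])
    show "runs (Seq (mark_reachable 2 4) (Seq (mark_reachable 3 5) (for_loop 7 1 ?test))) s
        (mark_time B + (mark_time B + loop_time B 2)) ?Q"
    proof (rule runs_Seq[OF *], rule runs_Seq)
      fix s1 :: state
      assume s1: "(\<forall>x<7. regs s1 x = regs s x) \<and> (\<forall>a. a \<noteq> 2 \<longrightarrow> arrays s1 a = arrays s a) \<and> ?marked 2 b s1"
      then have k: "search_state (input_state w n) xs found s1" by (intro keep) auto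
      then have inp1: "input_state w n s1" by (simp add: search_state_def)
      have lt1: "regs s1 3 < n" "regs s1 4 < n" "regs s1 5 < n" "regs s1 6 < n"
        using regs[OF k] lt by simp_all
      show "runs (mark_reachable 3 5) s1 (mark_time B) (search_state J xs found)"
      proof (rule runs_mono[OF runs_mark_reachable[OF inp1 w B lt1 _ _ refl]])
        fix s2 :: state
        assume s2: "(\<forall>x<7. regs s2 x = regs s1 x) \<and> (\<forall>a. a \<noteq> 3 \<longrightarrow> arrays s2 a = arrays s1 a) \<and>
          (\<forall>x<n. arrays s2 3 x = of_bool ((regs s1 5, x)
            \<in> (inner_arcs ?R (regs s1 3) (regs s1 4) (regs s1 5) (regs s1 6))\<^sup>*))"
        then have "search_state (input_state w n) xs found s2" using s1 by (intro keep) auto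
        moreover have "?marked 3 c s2" using s2 regs[OF k] by simp
        moreover have "?marked 2 b s2" using s2 s1 by simp
        ultimately show "search_state J xs found s2" by (simp add: search_state_def J_def)
      qed simp_all
    qed (rule final)
  next
    assume "\<not> bval is_end_arcs s"
    then have "\<not> meeting ?R n xs" using test by (simp add: meeting_def a_def b_def c_def d_def)
    then have "runs Skip s 1 ?Q" using s by (intro runs_Skip) simp
    then show "runs Skip s (mark_time B + (mark_time B + loop_time B 2)) ?Q"
      by (rule runs_mono) (simp_all add: loop_time_def)
  qed
qed

text \<open>The case of equal loop variables finds the loops of the digraph.\<close>

definition find_two_cycle :: com where
  "find_two_cycle = for_loop 3 1 (for_loop 4 1 (Cond (Conj (is_arc 3 4) (is_arc 4 3)) (SetReg 2 (Const 1)) Skip))"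

definition search_meeting :: com where
  "search_meeting = for_loop 3 1 (for_loop 4 1 (for_loop 5 1 (for_loop 6 1 find_meeting)))"

lemma runs_find_two_cycle:
  assumes s: "input_state w n s" "regs s 2 = 0" and w: "n * n = length w" and B: "n \<le> B"
  shows "runs find_two_cycle s (loop_time B (loop_time B 2)) (\<lambda>s. input_state w n s \<and>
    regs s 2 = of_bool (\<exists>u<n. \<exists>v<n. (u, v) \<in> code_arcs w n \<and> (v, u) \<in> code_arcs w n))"
proof -
  let ?R = "code_arcs w n"
  have "searches (input_state w n) n (Suc (Suc 0)) (Cond (Conj (is_arc 3 4) (is_arc 4 3)) (SetReg 2 (Const 1)) Skip)
      (\<lambda>xs. (xs ! 0, xs ! 1) \<in> ?R \<and> (xs ! 1, xs ! 0) \<in> ?R) 2"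
  proof (rule searches_test)
    fix xs s
    assume xs: "length xs = Suc (Suc 0)" "set xs \<subseteq> {..<n}" and inp: "input_state w n s"
      and regs: "\<And>i. i < Suc (Suc 0) \<Longrightarrow> regs s (3 + i) = xs ! i"
    have r: "regs s 3 = xs ! 0" "regs s 4 = xs ! 1" using regs[of 0] regs[of 1] by simp_all
    have "xs ! 0 < n" "xs ! 1 < n" using xs nth_mem[of _ xs] by force+
    then show "bval (Conj (is_arc 3 4) (is_arc 4 3)) s \<longleftrightarrow> (xs ! 0, xs ! 1) \<in> ?R \<and> (xs ! 1, xs ! 0) \<in> ?R"
      using bval_is_arc[OF inp w] r by simp
  qed (simp add: input_state_set_reg)
  note l1 = searches_loop[OF this _ B input_state_set_reg]
  note l0 = searches_loop[OF l1 _ B input_state_set_reg]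
  have "runs find_two_cycle s (loop_time B (loop_time B 2)) (search_state (input_state w n) []
      (False \<or> (\<exists>u<n. \<exists>v<n. (u, v) \<in> ?R \<and> (v, u) \<in> ?R)))"
    using l0[unfolded searches_def, rule_format, of "[]" False s] s
    by (simp add: find_two_cycle_def search_state_def input_state_def)
  then show ?thesis by (rule runs_mono) (simp_all add: search_state_def)
qed

lemma runs_search_meeting:
  assumes s: "input_state w n s" "regs s 2 = 0" and w: "n * n = length w" and B: "n \<le> B" "n * n \<le> B"
  shows "runs search_meeting s (loop_time B (loop_time B (loop_time B (loop_time B (meeting_time B))))) (\<lambda>s.
    regs s 2 = of_bool (\<exists>a<n. \<exists>b<n. \<exists>c<n. \<exists>d<n. meeting (code_arcs w n) n [a, b, c, d]))"
proof -
  have "searches (input_state w n) n (Suc (Suc (Suc (Suc 0)))) find_meeting (meeting (code_arcs w n) n) (meeting_time B)"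
    using searches_find_meeting[OF w B] by (simp add: eval_nat_numeral)
  note l3 = searches_loop[OF this _ B(1) input_state_set_reg]
  note l2 = searches_loop[OF l3 _ B(1) input_state_set_reg]
  note l1 = searches_loop[OF l2 _ B(1) input_state_set_reg]
  note l0 = searches_loop[OF l1 _ B(1) input_state_set_reg]
  have "runs search_meeting s (loop_time B (loop_time B (loop_time B (loop_time B (meeting_time B)))))
    (search_state (input_state w n) [] (False \<or> (\<exists>a<n. \<exists>b<n. \<exists>c<n. \<exists>d<n. meeting (code_arcs w n) n [a, b, c, d])))"
    using l0[unfolded searches_def, rule_format, of "[]" False s] s
    by (simp add: search_meeting_def search_state_def input_state_def)
  then show ?thesis by (rule runs_mono) (simp_all add: search_state_def)
qed

section \<open>The complete decision procedure\<close>

text \<open>A square root without multiplication: register 10 keeps the square of register 1 by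
  \<open>(n + 1) * (n + 1) = n * n + n + n + 1\<close>.\<close>

definition find_size :: com where
  "find_size = While (Less (Reg 10) (Reg 0))
     (Seq (SetReg 10 (Plus (Reg 10) (Plus (Reg 1) (Plus (Reg 1) (Const 1)))))
       (SetReg 1 (Plus (Reg 1) (Const 1))))"

text \<open>Entry 0 is 0 in the initial state; the last round writes entry \<open>n\<close>, one
  past the last row.\<close>

definition find_offsets :: com where
  "find_offsets = for_loop 3 1
     (SetCell 1 (Plus (Reg 3) (Const 1)) (Plus (Cell 1 (Reg 3)) (Reg 1)))"

text \<open>Words of non-square length and codes of digraphs with a loop or 2-cycle are outside
  \<open>Pi'\<close>. Register 0 initially holds the length, so every branch must overwrite it with
  the answer; a word of length 1 would otherwise count as accepted.\<close>

definition decide :: com where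
  "decide = Seq find_size (Cond (Equal (Reg 10) (Reg 0))
     (Seq find_offsets (Seq find_two_cycle (Cond (Equal (Reg 2) (Const 0))
       (Seq search_meeting (SetReg 0 (Reg 2))) (SetReg 0 (Const 0)))))
     (SetReg 0 (Const 0)))"

text \<open>\<open>B\<close> is the input length, which bounds both \<open>n\<close> and
  \<open>n * n\<close>; every loop is charged with it, at the price of a higher degree.\<close>

definition decide_time :: "nat \<Rightarrow> nat" where
  "decide_time B = (B * (1 + 1 + 1) + 1) + (1 + (loop_time B 1 + (loop_time B (loop_time B 2) +
     (1 + (loop_time B (loop_time B (loop_time B (loop_time B (meeting_time B)))) + 1)))))"

definition accepts :: "bool list \<Rightarrow> nat \<Rightarrow> bool" where
  "accepts w n \<longleftrightarrow> n * n = length w \<and>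
     \<not> (\<exists>u<n. \<exists>v<n. (u, v) \<in> code_arcs w n \<and> (v, u) \<in> code_arcs w n) \<and>
     (\<exists>a<n. \<exists>b<n. \<exists>c<n. \<exists>d<n. meeting (code_arcs w n) n [a, b, c, d])"

definition sized_state :: "bool list \<Rightarrow> nat \<Rightarrow> state \<Rightarrow> bool" where
  "sized_state w n s \<longleftrightarrow> regs s 0 = length w \<and> regs s 1 = n \<and> regs s 2 = 0 \<and> regs s 10 = n * n \<and>
     arrays s = arrays (initial_state w) \<and> (\<forall>k<n. k * k < length w)"

lemma runs_find_size:
  "runs find_size (initial_state w) (length w * (1 + 1 + 1) + 1)
     (\<lambda>s. \<exists>n. sized_state w n s \<and> length w \<le> n * n)"
proof -
  have "runs find_size (initial_state w) ((length w - 0) * (1 + 1 + 1) + 1)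
      (\<lambda>s. \<not> bval (Less (Reg 10) (Reg 0)) s \<and> (\<exists>n. sized_state w n s))"
    unfolding find_size_def
  proof (rule runs_While)
    fix n s
    assume s: "sized_state w n s" "bval (Less (Reg 10) (Reg 0)) s"
    then have lt: "n * n < length w" by (simp add: sized_state_def)
    then have "n < length w" using le_square[of n] by linarith
    moreover have "runs (Seq (SetReg 10 (Plus (Reg 10) (Plus (Reg 1) (Plus (Reg 1) (Const 1)))))
        (SetReg 1 (Plus (Reg 1) (Const 1)))) s (1 + 1) (sized_state w (Suc n))"
    proof (rule runs_Seq)
      show "runs (SetReg 10 (Plus (Reg 10) (Plus (Reg 1) (Plus (Reg 1) (Const 1))))) s 1
          (\<lambda>s'. s' = set_reg 10 (Suc n * Suc n) s)"
        by (rule runs_SetReg) (use s in \<open>simp add: sized_state_def algebra_simps\<close>)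
      fix s' assume "s' = set_reg 10 (Suc n * Suc n) s"
      then show "runs (SetReg 1 (Plus (Reg 1) (Const 1))) s' 1 (sized_state w (Suc n))"
        by (intro runs_SetReg) (use s lt in \<open>auto simp: sized_state_def less_Suc_eq\<close>)
    qed
    ultimately show "n < length w \<and> runs (Seq (SetReg 10 (Plus (Reg 10) (Plus (Reg 1) (Plus (Reg 1) (Const 1)))))
        (SetReg 1 (Plus (Reg 1) (Const 1)))) s (1 + 1) (sized_state w (Suc n))" ..
  qed (simp add: sized_state_def initial_state_def)
  then show ?thesis
    by (rule runs_mono) (auto simp: sized_state_def not_less)
qed

lemma runs_find_offsets:
  assumes s: "sized_state w n s" and n: "n \<le> B"
  shows "runs find_offsets s (loop_time B 1) (\<lambda>s. input_state w n s \<and> regs s 2 = 0)"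
  unfolding find_offsets_def
proof (rule runs_for_loop[where N = n and I = "\<lambda>i (s :: state). regs s 0 = length w \<and> regs s 1 = n \<and> regs s 2 = 0 \<and>
      arrays s 0 = arrays (initial_state w) 0 \<and> (\<forall>u\<le>i. arrays s 1 u = u * n)"])
  show "regs s 1 = n" using s by (simp add: sized_state_def)
  fix i and s :: state
  assume "regs s 0 = length w \<and> regs s 1 = n \<and> regs s 2 = 0 \<and> arrays s 0 = arrays (initial_state w) 0 \<and>
    (\<forall>u\<le>i. arrays s 1 u = u * n)" "regs s 3 = i" "regs s 1 = n" "i < n"
  then show "runs (SetCell 1 (Plus (Reg 3) (Const 1)) (Plus (Cell 1 (Reg 3)) (Reg 1))) s 1 (\<lambda>s'.
      regs s' 3 = i \<and> regs s' 1 = n \<and> regs (set_reg 3 (Suc i) s') 0 = length w \<and>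
      regs (set_reg 3 (Suc i) s') 1 = n \<and> regs (set_reg 3 (Suc i) s') 2 = 0 \<and>
      arrays (set_reg 3 (Suc i) s') 0 = arrays (initial_state w) 0 \<and>
      (\<forall>u\<le>Suc i. arrays (set_reg 3 (Suc i) s') 1 u = u * n))"
    by (intro runs_SetCell) (auto simp: le_Suc_eq)
qed (use s n in \<open>auto simp: sized_state_def initial_state_def input_state_def\<close>)

lemma runs_decide:
  "runs decide (initial_state w) (decide_time (length w)) (\<lambda>s. regs s 0 = 1 \<longleftrightarrow> (\<exists>n. accepts w n))"
  unfolding decide_def decide_time_def
proof (rule runs_Seq[OF runs_find_size])
  let ?B = "length w"
  let ?Q = "\<lambda>s. regs s 0 = 1 \<longleftrightarrow> (\<exists>n. accepts w n)"
  fix s :: state assume "\<exists>n. sized_state w n s \<and> length w \<le> n * n"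
  then obtain n where s: "sized_state w n s" and le: "length w \<le> n * n" by blast
  \<comment> \<open>Smaller numbers have a square below the length and larger ones a square above
    it, so \<open>n\<close> is the only possible size.\<close>
  have accepts_iff: "(\<exists>k. accepts w k) \<longleftrightarrow> accepts w n"
  proof
    assume "\<exists>k. accepts w k"
    then obtain k where k: "accepts w k" ..
    then have kk: "k * k = length w" by (simp add: accepts_def)
    then have "\<not> k < n" using s by (auto simp: sized_state_def)
    moreover have "\<not> n < k"
    proof
      assume "n < k"
      then have "n * n < k * k" by (intro mult_strict_mono) auto
      then show False using kk le by simp
    qed
    ultimately show "accepts w n" using k by (metis linorder_neqE_nat)
  qed blast
  show "runs (Cond (Equal (Reg 10) (Reg 0)) (Seq find_offsets (Seq find_two_cycle (Cond (Equal (Reg 2) (Const 0))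
       (Seq search_meeting (SetReg 0 (Reg 2))) (SetReg 0 (Const 0))))) (SetReg 0 (Const 0))) s
     (1 + (loop_time ?B 1 + (loop_time ?B (loop_time ?B 2) +
     (1 + (loop_time ?B (loop_time ?B (loop_time ?B (loop_time ?B (meeting_time ?B)))) + 1))))) ?Q"
  proof (rule runs_Cond)
    assume "bval (Equal (Reg 10) (Reg 0)) s"
    then have w: "n * n = length w" using s by (simp add: sized_state_def)
    then have B: "n \<le> ?B" "n * n \<le> ?B" using le_square[of n] by simp_all
    let ?R = "code_arcs w n"
    let ?bad = "\<exists>u<n. \<exists>v<n. (u, v) \<in> ?R \<and> (v, u) \<in> ?R"
    let ?good = "\<exists>a<n. \<exists>b<n. \<exists>c<n. \<exists>d<n. meeting ?R n [a, b, c, d]"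
    have acc: "accepts w n \<longleftrightarrow> \<not> ?bad \<and> ?good" using w by (simp only: accepts_def simp_thms)
    show "runs (Seq find_offsets (Seq find_two_cycle (Cond (Equal (Reg 2) (Const 0))
       (Seq search_meeting (SetReg 0 (Reg 2))) (SetReg 0 (Const 0))))) s
     (loop_time ?B 1 + (loop_time ?B (loop_time ?B 2) +
     (1 + (loop_time ?B (loop_time ?B (loop_time ?B (loop_time ?B (meeting_time ?B)))) + 1)))) ?Q"
    proof (rule runs_Seq[OF runs_find_offsets[OF s B(1)]], rule runs_Seq)
      fix s1 assume "input_state w n s1 \<and> regs s1 2 = 0"
      then show "runs find_two_cycle s1 (loop_time ?B (loop_time ?B 2))
          (\<lambda>s. input_state w n s \<and> regs s 2 = of_bool ?bad)"
        using runs_find_two_cycle w B by blast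
    next
      fix s2 assume s2: "input_state w n s2 \<and> regs s2 2 = of_bool ?bad"
      show "runs (Cond (Equal (Reg 2) (Const 0)) (Seq search_meeting (SetReg 0 (Reg 2))) (SetReg 0 (Const 0))) s2
          (1 + (loop_time ?B (loop_time ?B (loop_time ?B (loop_time ?B (meeting_time ?B)))) + 1)) ?Q"
      proof (rule runs_Cond)
        assume "bval (Equal (Reg 2) (Const 0)) s2"
        then have "regs s2 2 = 0" "\<not> ?bad" using s2 by simp_all
        then have acc': "accepts w n \<longleftrightarrow> ?good" using acc by blast
        show "runs (Seq search_meeting (SetReg 0 (Reg 2))) s2
            (loop_time ?B (loop_time ?B (loop_time ?B (loop_time ?B (meeting_time ?B)))) + 1) ?Q"
        proof (rule runs_Seq[OF runs_search_meeting[OF _ \<open>regs s2 2 = 0\<close> w B]])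
          fix s3 :: state assume "regs s3 2 = of_bool ?good"
          then have "regs s3 2 = of_bool (accepts w n)" unfolding acc' .
          then show "runs (SetReg 0 (Reg 2)) s3 1 ?Q"
            by (intro runs_SetReg) (simp add: accepts_iff)
        qed (use s2 in blast)
      next
        assume "\<not> bval (Equal (Reg 2) (Const 0)) s2"
        then have "?bad" using s2 by (cases ?bad) simp_all
        then have "runs (SetReg 0 (Const 0)) s2 1 ?Q"
          using acc by (intro runs_SetReg) (simp add: accepts_iff)
        then show "runs (SetReg 0 (Const 0)) s2
            (loop_time ?B (loop_time ?B (loop_time ?B (loop_time ?B (meeting_time ?B)))) + 1) ?Q"
          by (rule runs_mono) simp_all
      qed
    qed
  next
    assume "\<not> bval (Equal (Reg 10) (Reg 0)) s"
    then have "\<not> accepts w n" using s by (simp add: sized_state_def accepts_def)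
    then have "runs (SetReg 0 (Const 0)) s 1 ?Q"
      by (intro runs_SetReg) (simp add: accepts_iff)
    then show "runs (SetReg 0 (Const 0)) s (loop_time ?B 1 + (loop_time ?B (loop_time ?B 2) +
     (1 + (loop_time ?B (loop_time ?B (loop_time ?B (loop_time ?B (meeting_time ?B)))) + 1)))) ?Q"
      by (rule runs_mono) simp_all
  qed
qed

section \<open>Words and adjacency matrices\<close>

lemma concat_map_upt:
  "concat (map (\<lambda>u. map (f u) [0..<n]) [0..<m]) = map (\<lambda>i. f (i div n) (i mod n)) [0..<m * n]"
proof (induction m)
  case (Suc m)
  have "[0..<Suc m * n] = [0..<m * n] @ [m * n..<m * n + n]"
    by (metis add.commute mult_Suc upt_add_eq_append zero_le)
  also have "[m * n..<m * n + n] = map (\<lambda>v. v + m * n) [0..<n]"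
    by (simp add: map_add_upt add.commute)
  finally show ?case using Suc.IH by (simp del: mult_Suc)
qed simp

lemma code_arcs_encode_digraph:
  assumes "pair_wf_digraph G" "pverts G = {..<n}"
  shows "length (encode_digraph G) = n * n" "code_arcs (encode_digraph G) n = parcs G"
proof -
  interpret pair_wf_digraph G by fact
  have eq: "encode_digraph G = map (\<lambda>i. (i div n, i mod n) \<in> parcs G) [0..<n * n]"
    using assms(2) by (simp add: encode_digraph_def concat_map_upt)
  then show "length (encode_digraph G) = n * n" by simp
  have "encode_digraph G ! (u * n + v) \<longleftrightarrow> (u, v) \<in> parcs G" if "u < n" "v < n" for u v
  proof -
    have "u * n + v < Suc u * n" using that by simp
    also have "\<dots> \<le> n * n" using that by (intro mult_le_mono1) simp
    finally show ?thesis using that eq by simp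
  qed
  then show "code_arcs (encode_digraph G) n = parcs G"
    using assms(2) wellformed' by (auto simp: code_arcs_def)
qed

text \<open>Decoding the code of this digraph returns \<open>code_arcs w n\<close>, and index
  \<open>i\<close> is the cell in row \<open>i div n\<close> and column \<open>i mod n\<close>, so
  the words agree entrywise. Thus every word of square length is a code.\<close>

lemma encode_digraph_code_arcs:
  assumes "n * n = length w"
  shows "encode_digraph \<lparr>pverts = {..<n}, parcs = code_arcs w n\<rparr> = w"
proof (rule nth_equalityI)
  let ?G = "\<lparr>pverts = {..<n}, parcs = code_arcs w n\<rparr>"
  have G: "pair_wf_digraph ?G" by (auto simp: pair_wf_digraph_def code_arcs_def)
  note enc = code_arcs_encode_digraph[OF G, of n]
  show "length (encode_digraph ?G) = length w" using enc assms by simp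
  fix i assume "i < length (encode_digraph ?G)"
  then have i: "i < n * n" using enc by simp
  \<comment> \<open>An index exists only for positive \<open>n\<close>, and only then is
    \<open>i mod n\<close> below \<open>n\<close>.\<close>
  then have "0 < n" by (cases n) auto
  then have "i div n < n" "i mod n < n" using i by (simp_all add: less_mult_imp_div_less)
  moreover have "code_arcs (encode_digraph ?G) n = code_arcs w n" using enc by simp
  ultimately have "encode_digraph ?G ! (i div n * n + i mod n) \<longleftrightarrow> w ! (i div n * n + i mod n)"
    unfolding code_arcs_def by blast
  then show "encode_digraph ?G ! i = w ! i" by simp
qed

lemma accepts_iff_contains:
  assumes "pair_wf_digraph G" "pverts G = {..<n}"
  shows "accepts (encode_digraph G) n \<longleftrightarrow> oriented_graph G \<and> contains_induced_subdivision G A4_minus"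
proof -
  interpret pair_wf_digraph G by fact
  note code = code_arcs_encode_digraph[OF assms]
  have fin: "finite (parcs G)" using finite_code_arcs code(2) by metis
  have or: "oriented_graph G \<longleftrightarrow> \<not> (\<exists>u<n. \<exists>v<n. (u, v) \<in> parcs G \<and> (v, u) \<in> parcs G)" (is "_ \<longleftrightarrow> \<not> ?bad")
  proof
    assume "\<not> ?bad"
    then have asym: "(v, u) \<notin> parcs G" if "(u, v) \<in> parcs G" for u v
      using that wellformed'[OF that] assms(2) by blast
    \<comment> \<open>Asymmetry applied to a loop contradicts itself.\<close>
    then have "fst e \<noteq> snd e" if "e \<in> parcs G" for e
      using that by (metis prod.collapse)
    then have "pair_digraph G"
      by unfold_locales (use fin assms(2) in auto)
    then show "oriented_graph G" using asym unfolding oriented_graph_def by blast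
  next
    assume "oriented_graph G"
    then have "(v, u) \<notin> parcs G" if "(u, v) \<in> parcs G" for u v
      using that oriented_graphD(3) by metis
    then show "\<not> ?bad" by blast
  qed
  show ?thesis
  proof (cases "oriented_graph G")
    case True
    have "(\<exists>a<n. \<exists>b<n. \<exists>c<n. \<exists>d<n. meeting (parcs G) n [a, b, c, d]) \<longleftrightarrow> contains_induced_subdivision G A4_minus"
      unfolding contains_A4_minus_iff[OF True] assms(2)
      unfolding Bex_def lessThan_iff by (simp add: meeting_def common_reach_def)
    then show ?thesis using True or code by (simp add: accepts_def)
  next
    case False
    then show ?thesis unfolding accepts_def code or by blast
  qed
qed

lemma accepts_iff_Pi': "(\<exists>n. accepts w n) \<longleftrightarrow> w \<in> Pi' A4_minus"
proof
  assume "\<exists>n. accepts w n"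
  then obtain n where n: "accepts w n" ..
  let ?G = "\<lparr>pverts = {..<n}, parcs = code_arcs w n\<rparr>"
  have G: "pair_wf_digraph ?G" by (auto simp: pair_wf_digraph_def code_arcs_def)
  have w: "encode_digraph ?G = w" using n by (intro encode_digraph_code_arcs) (simp add: accepts_def)
  have "oriented_graph ?G \<and> contains_induced_subdivision ?G A4_minus"
    using accepts_iff_contains[OF G] n w by simp
  then show "w \<in> Pi' A4_minus" unfolding Pi'_def using w by (intro CollectI exI[of _ ?G]) auto
next
  assume "w \<in> Pi' A4_minus"
  then show "\<exists>n. accepts w n"
    unfolding Pi'_def using accepts_iff_contains oriented_graphD(1) by blast
qed

section \<open>The polynomial time bound\<close>

text \<open>The bounds are built from constants, the length, sums and products only, so they equal
  polynomials exactly and closure rules suffice.\<close>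

definition polynomial_function :: "(nat \<Rightarrow> nat) \<Rightarrow> bool" where
  "polynomial_function f \<longleftrightarrow> (\<exists>p :: nat poly. \<forall>x. f x = poly p x)"

lemma polynomial_function_intros:
  "polynomial_function (\<lambda>x. c)" "polynomial_function (\<lambda>x. x)"
  "polynomial_function f \<Longrightarrow> polynomial_function g \<Longrightarrow> polynomial_function (\<lambda>x. f x + g x)"
  "polynomial_function f \<Longrightarrow> polynomial_function g \<Longrightarrow> polynomial_function (\<lambda>x. f x * g x)"
proof -
  show "polynomial_function (\<lambda>x. c)" unfolding polynomial_function_def by (intro exI[of _ "[:c:]"]) simp
  show "polynomial_function (\<lambda>x. x)" unfolding polynomial_function_def by (intro exI[of _ "[:0, 1:]"]) simp
  show "polynomial_function f \<Longrightarrow> polynomial_function g \<Longrightarrow> polynomial_function (\<lambda>x. f x + g x)"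
    unfolding polynomial_function_def by (metis poly_add)
  show "polynomial_function f \<Longrightarrow> polynomial_function g \<Longrightarrow> polynomial_function (\<lambda>x. f x * g x)"
    unfolding polynomial_function_def by (metis poly_mult)
qed

lemma polynomial_function_decide_time: "polynomial_function decide_time"
proof -
  have "polynomial_function (\<lambda>B. decide_time B)"
    unfolding decide_time_def meeting_time_def mark_time_def loop_time_def
    by (intro polynomial_function_intros)
  then show ?thesis by simp
qed

theorem mainTheorem4:
  shows "polynomial_time_decidable (Pi' A4_minus)"
proof -
  obtain p where p: "\<And>x. decide_time x = poly p x"
    using polynomial_function_decide_time unfolding polynomial_function_def by blast
  show ?thesis
    unfolding polynomial_time_decidable_def
  proof (rule exI[of _ decide], rule exI[of _ p], rule allI)
    fix w
    show "\<exists>t s. exec decide (initial_state w) t s \<and> t \<le> poly p (length w) \<and> (regs s 0 = 1 \<longleftrightarrow> w \<in> Pi' A4_minus)"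
      using runs_decide[of w] unfolding runs_def p accepts_iff_Pi' .
  qed
qed

end
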